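(* There exist absolute constants $c>0$ and $p_0$ such that for every prime $p>p_0$ and every set $A\subset\mathbb{F}_p^*$ with $2\le |A|<\sqrt{p}$, all of the following hold: (1) $\max\bigl(|A\cdot A|,\;|A-A|\bigr)\;\geq\; c\,|A|^{1+\frac1{11}}\,\dfrac{1}{\log^{\frac{4}{11}}|A|}$; (2) $\max\bigl(|A:A|,\;|A+A|\bigr)\;\geq\; c\,|A|^{1+\frac1{11}}$; (3) $\max\bigl(|A:A|,\;|A-A|\bigr)\;\geq\; c\,|A|^{1+\frac1{11}}$.
   Context: $\mathbb{F}_p$ is the field with $p$ elements ($p$ prime) and $\mathbb{F}_p^*$ is its multiplicative group. For $A\subset\mathbb{F}_p^*$: $A+A=\{a_1+a_2\}$, $A-A=\{a_1-a_2\}$, $A\cdot A=\{a_1a_2\}$, and $A:A=\{a_1/a_2\}$, with $a_1,a_2$ ranging over $A$. $|\cdot|$ denotes cardinality, and $\log^{4/11}|A|$ means $(\log|A|)^{4/11}$. The constants are independent of $p$ and $A$. *)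

theory Defs
  imports Complex_Main "HOL-Number_Theory.Residues"
begin

(* The field F_p is residue_ring (int p), with carrier {0..p-1}. It is used as a record, not as a
   type, so that constants can be quantified outside "for all p". Its unit group F_p^* is
   Units (residue_ring (int p)). Sumset and product set are the library's <+> and <#>. *)

definition diff_set :: "('a, 'm) ring_scheme \<Rightarrow> 'a set \<Rightarrow> 'a set \<Rightarrow> 'a set" where
  "diff_set R A B = {a \<ominus>\<^bsub>R\<^esub> b | a b. a \<in> A \<and> b \<in> B}"

definition ratio_set :: "('a, 'm) monoid_scheme \<Rightarrow> 'a set \<Rightarrow> 'a set \<Rightarrow> 'a set" where
  "ratio_set G A B = {a \<otimes>\<^bsub>G\<^esub> inv\<^bsub>G\<^esub> b | a b. a \<in> A \<and> b \<in> B}"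

end

theory Submission
  imports Defs "HOL-Library.Set_Algebras" "HOL-Library.Product_Plus" "HOL-Analysis.Harmonic_Numbers"
begin

text \<open>Let \<open>s = 1\<close> or \<open>s = -1\<close> according to whether sums or differences are considered. By Pluennecke's
  inequality one may pass to a large subset of \<open>A\<close> for which \<open>A + sA + sA + sA\<close> is as small as a
  threefold sum should be. Multiplicative structure gives a point \<open>z\<close> such that \<open>a b \<in> z A\<close> for many
  pairs \<open>(a, b)\<close>, and sets \<open>H\<close>, \<open>T\<close> such that each dilate \<open>h A\<close> meets \<open>z A\<close> in many points and each
  \<open>t H\<close> meets \<open>z A\<close> in many points. Consider the set of slopes \<open>r = (t1 - t2) / (h1 - h2)\<close>. If some \<open>r + s\<close> is
  not a slope, then \<open>X + (r + s) Y\<close> has full size for all \<open>X \<subseteq> T\<close> and \<open>Y \<subseteq> H\<close>; if there is no such \<open>r\<close>,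
  every element of the field is a slope, and \<open>T + r H\<close> is large for some \<open>r\<close> since \<open>card A ^ 2 < p\<close>. On
  the other hand \<open>(h1 - h2) X + (t1 - t2) Y\<close> is small, because each of the four dilates in it can be
  exchanged for \<open>z A\<close> at the cost of a factor \<open>card (A + sA)\<close> over the number of common points. Taking for \<open>Y\<close>
  the points of \<open>H\<close> with \<open>t2 Y \<subseteq> z A\<close> saves one of these factors in the first case.\<close>

section \<open>Sumset inequalities up to a congruence\<close>

text \<open>Residues are represented by arbitrary integers: \<open>q\<close> will be reduction modulo \<open>p\<close>, and \<open>N\<close> counts
  residue classes. Sets can then be manipulated by identities of the ring of integers.\<close>

locale add_cong =
  fixes q :: "'a::ab_group_add \<Rightarrow> 'b"
  assumes q_add_right_cancel: "q (x + z) = q (y + z) \<longleftrightarrow> q x = q y"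
begin

definition N :: "'a set \<Rightarrow> nat" where
  "N X = card (q ` X)"

lemma q_add_left_cancel: "q (z + x) = q (z + y) \<longleftrightarrow> q x = q y"
  using q_add_right_cancel[of x z y] by (simp add: add.commute)

lemma q_add_cong: "q x = q x' \<Longrightarrow> q y = q y' \<Longrightarrow> q (x + y) = q (x' + y')"
  by (metis q_add_right_cancel q_add_left_cancel)

lemma q_uminus_cong: "q x = q y \<Longrightarrow> q (- x) = q (- y)"
  using q_add_right_cancel[of x "- x - y" y] by simp

lemma q_image_add_mono:
  assumes "q ` X \<subseteq> q ` X'" "q ` Y \<subseteq> q ` Y'"
  shows "q ` (X + Y) \<subseteq> q ` (X' + Y')"
proof
  fix u assume "u \<in> q ` (X + Y)"
  then obtain x y where u: "u = q (x + y)" and xy: "x \<in> X" "y \<in> Y"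
    by (auto elim: set_plus_elim)
  obtain x' where x': "x' \<in> X'" "q x = q x'"
    using assms(1) xy by blast
  obtain y' where y': "y' \<in> Y'" "q y = q y'"
    using assms(2) xy by blast
  have "u = q (x' + y')"
    using q_add_cong[OF x'(2) y'(2)] u by simp
  then show "u \<in> q ` (X' + Y')"
    using x' y' by blast
qed

lemma N_le: "finite Y \<Longrightarrow> q ` X \<subseteq> q ` Y \<Longrightarrow> N X \<le> N Y"
  by (simp add: N_def card_mono)

lemma N_mono: "finite Y \<Longrightarrow> X \<subseteq> Y \<Longrightarrow> N X \<le> N Y"
  by (simp add: N_le image_mono)

lemma N_pos: "finite X \<Longrightarrow> X \<noteq> {} \<Longrightarrow> 0 < N X"
  by (simp add: N_def card_gt_0_iff)

lemma N_empty [simp]: "N {} = 0"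
  by (simp add: N_def)

text \<open>The hypothesis says that \<open>f\<close> descends to an injective map on residue
  classes; \<open>inv_into\<close> supplies the representatives for the induced bijection.\<close>

lemma N_image_eq:
  assumes "\<And>x y. x \<in> X \<Longrightarrow> y \<in> X \<Longrightarrow> q (f x) = q (f y) \<longleftrightarrow> q x = q y"
  shows "N (f ` X) = N X"
proof -
  have inv: "inv_into X q u \<in> X" "q (inv_into X q u) = u" if "u \<in> q ` X" for u
    using that by (auto simp: inv_into_into f_inv_into_f)
  have "bij_betw (\<lambda>u. q (f (inv_into X q u))) (q ` X) (q ` f ` X)"
  proof (rule bij_betw_imageI)
    show "inj_on (\<lambda>u. q (f (inv_into X q u))) (q ` X)"
      by (rule inj_onI) (metis assms inv)
    show "(\<lambda>u. q (f (inv_into X q u))) ` q ` X = q ` f ` X"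
      unfolding image_image using assms inv by (intro image_cong) auto
  qed
  then show ?thesis
    by (simp add: N_def bij_betw_same_card)
qed

lemma N_translate: "N (X + {c}) = N X"
proof -
  have "X + {c} = (\<lambda>x. x + c) ` X"
    by (auto simp: set_plus_def)
  then show ?thesis
    by (simp add: N_image_eq q_add_right_cancel)
qed

lemma set_plus_eq_empty: "X + Y = {} \<longleftrightarrow> X = {} \<or> Y = ({} :: 'a set)"
  by (auto simp: set_plus_def)

text \<open>Petridis' induction on \<open>C\<close>: of the new translate \<open>X + B + {c}\<close> the part \<open>W + B + {c}\<close> is old, where
  \<open>W\<close> collects the \<open>x\<close> with \<open>x + c\<close> already in \<open>X + C\<close>, and minimality of \<open>X\<close> makes this part large.\<close>

lemma petridis_step:
  fixes K :: real
  assumes fin: "finite X" "finite B" "finite C"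
    and K: "real (N (X + B)) = K * real (N X)"
    and least: "\<And>Z. Z \<subseteq> X \<Longrightarrow> K * real (N Z) \<le> real (N (Z + B))"
  shows "real (N (X + B + C)) \<le> K * real (N (X + C))"
  using \<open>finite C\<close>
proof (induction C rule: finite_induct)
  case empty
  then show ?case by (simp add: set_plus_def)
next
  case (insert c C)
  have ins: "Y + insert c C = (Y + C) \<union> (Y + {c})" for Y :: "'a set"
    by (auto simp: set_plus_def)
  define W where "W = {x \<in> X. q (x + c) \<in> q ` (X + C)}"
  have W: "W \<subseteq> X"
    by (auto simp: W_def)
  have finW: "finite W"
    using W fin finite_subset by blast
  have "q ` (W + {c}) = q ` (X + {c}) \<inter> q ` (X + C)"
  proof (intro equalityI subsetI IntI)
    fix u assume u: "u \<in> q ` (X + {c}) \<inter> q ` (X + C)"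
    then obtain x where "x \<in> X" "u = q (x + c)"
      by (auto simp: set_plus_def)
    then show "u \<in> q ` (W + {c})"
      using u unfolding W_def set_plus_def by blast
  qed (auto simp: W_def set_plus_def)
  moreover have "card (q ` (X + C) \<union> q ` (X + {c})) + card (q ` (X + {c}) \<inter> q ` (X + C))
      = card (q ` (X + C)) + card (q ` (X + {c}))"
    using card_Un_Int[of "q ` (X + C)" "q ` (X + {c})"] fin insert.hyps
    by (simp add: finite_set_plus Int_commute)
  ultimately have low: "N (X + insert c C) + N (W + {c}) = N (X + C) + N (X + {c})"
    unfolding N_def ins image_Un by simp
  have WB: "q ` (W + B + {c}) \<subseteq> q ` (X + B + C)"
  proof
    fix u assume "u \<in> q ` (W + B + {c})"
    then obtain x b where u: "u = q (x + b + c)" and x: "x \<in> W" and b: "b \<in> B"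
      by (auto simp: set_plus_def)
    obtain x' c' where x': "x' \<in> X" and c': "c' \<in> C" and eq: "q (x + c) = q (x' + c')"
      using x by (auto simp: W_def set_plus_def)
    have "q (x + c + b) = q (x' + c' + b)"
      using eq by (simp only: q_add_right_cancel)
    then have "u = q (x' + b + c')"
      using u by (simp add: ac_simps)
    then show "u \<in> q ` (X + B + C)"
      using x' c' b by (auto simp: set_plus_def)
  qed
  have "card (q ` (X + B + C) \<union> q ` (X + B + {c}))
      = card (q ` (X + B + C)) + card (q ` (X + B + {c}) - q ` (X + B + C))"
    by (metis Un_Diff_cancel card_Un_disjoint Diff_disjoint finite_imageI finite_set_plus
        fin(1,2) insert.hyps(1) finite_Diff finite.emptyI finite.insertI)
  also have "\<dots> \<le> card (q ` (X + B + C)) + card (q ` (X + B + {c}) - q ` (W + B + {c}))"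
    using WB fin by (intro add_left_mono card_mono) (auto simp: finite_set_plus)
  also have "card (q ` (X + B + {c}) - q ` (W + B + {c}))
      = card (q ` (X + B + {c})) - card (q ` (W + B + {c}))"
    using fin finW by (intro card_Diff_subset image_mono set_plus_mono2 subset_refl W) (simp add: finite_set_plus)
  finally have "N (X + B + insert c C) \<le> N (X + B + C) + (N (X + B + {c}) - N (W + B + {c}))"
    unfolding N_def ins image_Un .
  then have up: "N (X + B + insert c C) \<le> N (X + B + C) + (N (X + B) - N (W + B))"
    by (simp add: N_translate)
  have "N (W + B) \<le> N (X + B)"
    using W fin by (intro N_mono set_plus_mono2) (auto simp: finite_set_plus)
  then have "real (N (X + B + insert c C)) \<le> real (N (X + B + C)) + (real (N (X + B)) - real (N (W + B)))"
    using up by linarith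
  also have "\<dots> \<le> K * real (N (X + C)) + (K * real (N X) - K * real (N W))"
    using insert.IH K least[OF W] by linarith
  also have "\<dots> = K * (real (N (X + C)) + real (N X) - real (N W))"
    by (simp add: algebra_simps)
  also have "\<dots> = K * real (N (X + insert c C))"
    using arg_cong[OF low, of real] by (simp add: N_translate)
  finally show ?case .
qed

text \<open>\<open>X'\<close> minimises the growth ratio \<open>?f\<close> over the nonempty subsets
  of \<open>X\<close>. This is what \<open>petridis_step\<close> asks for, and the minimum is at
  most the ratio of \<open>X\<close> itself. One \<open>X'\<close> serves every \<open>C\<close>, so
  the inequality can be iterated.\<close>

lemma petridis:
  assumes "finite X" "X \<noteq> {}" "finite B"
  obtains X' where "X' \<subseteq> X" "X' \<noteq> {}"
    "\<And>C. finite C \<Longrightarrow> N (X' + B + C) * N X \<le> N (X + B) * N (X' + C)"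
proof -
  let ?S = "{Z. Z \<subseteq> X \<and> Z \<noteq> {}}"
  let ?f = "\<lambda>Z. real (N (Z + B)) / real (N Z)"
  have "finite ?S"
    using assms by simp
  moreover have "?S \<noteq> {}"
    using assms by auto
  ultimately obtain X' where X': "is_arg_min ?f (\<lambda>Z. Z \<in> ?S) X'"
    using ex_is_arg_min_if_finite by blast
  then have sub: "X' \<subseteq> X" "X' \<noteq> {}"
    by (auto simp: is_arg_min_def)
  have min: "?f X' \<le> ?f Z" if "Z \<subseteq> X" "Z \<noteq> {}" for Z
    using X' that by (force simp: is_arg_min_linorder)
  have finX': "finite X'"
    using sub assms finite_subset by blast
  have pos: "0 < N Z" if "Z \<subseteq> X" "Z \<noteq> {}" for Z
    using that assms finite_subset N_pos by blast
  have step: "N (X' + B + C) * N X \<le> N (X + B) * N (X' + C)" if C: "finite C" for C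
  proof -
    have "real (N (X' + B + C)) \<le> ?f X' * real (N (X' + C))"
    proof (rule petridis_step)
      show "?f X' * real (N Z) \<le> real (N (Z + B))" if "Z \<subseteq> X'" for Z
      proof (cases "Z = {}")
        case False
        then have Z: "Z \<subseteq> X" "Z \<noteq> {}"
          using that sub by auto
        show ?thesis
          using min[OF Z] pos[OF Z] by (simp add: pos_le_divide_eq)
      qed simp
    qed (use assms finX' C pos[OF sub] in auto)
    also have "\<dots> \<le> ?f X * real (N (X' + C))"
      using assms min[of X] by (intro mult_right_mono) auto
    finally have "real (N (X' + B + C)) * real (N X) \<le> real (N (X + B)) * real (N (X' + C))"
      using pos[of X] assms by (simp add: field_simps)
    then show ?thesis
      by (simp only: of_nat_mult[symmetric] of_nat_le_iff)
  qed
  show thesis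
    using that sub step by blast
qed

section \<open>Triangle inequalities for sums and for differences\<close>

text \<open>Translation by a point of the minimising \<open>W'\<close> embeds a copy of
  \<open>P + Q\<close> in \<open>W' + P + Q\<close>, which Petridis' inequality controls with
  \<open>C = Q\<close>.\<close>

lemma pluennecke_triangle:
  assumes fin: "finite P" "finite Q" "finite W"
  shows "N (P + Q) * N W \<le> N (P + W) * N (W + Q)"
proof (cases "W = {}")
  case False
  obtain W' where W': "W' \<subseteq> W" "W' \<noteq> {}"
    and pet: "\<And>C. finite C \<Longrightarrow> N (W' + P + C) * N W \<le> N (W + P) * N (W' + C)"
    using petridis[of W P] fin False by metis
  obtain w where w: "w \<in> W'"
    using W' by blast
  have finW': "finite W'"
    using W' fin finite_subset by blast
  have "N (P + Q) = N (P + Q + {w})"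
    by (simp add: N_translate)
  also have "\<dots> \<le> N (W' + P + Q)"
  proof (rule N_mono)
    show "finite (W' + P + Q)"
      using fin finW' by (simp add: finite_set_plus)
    have "P + {w} + Q \<subseteq> P + W' + Q"
      by (intro set_plus_mono2 subset_refl) (simp add: w)
    then show "P + Q + {w} \<subseteq> W' + P + Q"
      by (simp add: ac_simps)
  qed
  finally have "N (P + Q) * N W \<le> N (W + P) * N (W' + Q)"
    using pet[OF fin(2)] mult_le_mono1 order_trans by blast
  also have "\<dots> \<le> N (W + P) * N (W + Q)"
    using W' fin by (intro mult_le_mono2 N_mono set_plus_mono2) (auto simp: finite_set_plus)
  finally show ?thesis
    by (simp add: add.commute)
qed simp

text \<open>Fix one representation \<open>x + y\<close> of each class \<open>u\<close> of
  \<open>P + Q\<close> and send \<open>(u, w)\<close> to the classes of \<open>x - w\<close> and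
  \<open>w + y\<close>. Their sum returns \<open>u\<close>, hence \<open>x\<close>, and then
  \<open>w\<close>, so the map is injective.\<close>

lemma ruzsa_triangle:
  assumes fin: "finite P" "finite Q" "finite W"
  shows "N (P + Q) * N W \<le> N (P + uminus ` W) * N (W + Q)"
proof -
  define s where "s = inv_into (P \<times> Q) (\<lambda>(x, y). q (x + y))"
  have sum_eq: "q ` (P + Q) = (\<lambda>(x, y). q (x + y)) ` (P \<times> Q)"
    by (auto simp: set_plus_def)
  have s: "s u \<in> P \<times> Q" "q (fst (s u) + snd (s u)) = u" if "u \<in> q ` (P + Q)" for u
    using that inv_into_into[of u "\<lambda>(x, y). q (x + y)" "P \<times> Q"]
      f_inv_into_f[of u "\<lambda>(x, y). q (x + y)" "P \<times> Q"]
    unfolding sum_eq s_def by (auto simp: case_prod_beta)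
  define r where "r = inv_into W q"
  have r: "r w \<in> W" "q (r w) = w" if "w \<in> q ` W" for w
    using that by (auto simp: r_def inv_into_into f_inv_into_f)
  let ?g = "\<lambda>(u, w). (q (fst (s u) + - r w), q (r w + snd (s u)))"
  have "inj_on ?g (q ` (P + Q) \<times> q ` W)"
  proof (rule inj_onI, clarify)
    fix x y x' y' w w'
    assume *: "x \<in> P + Q" "w \<in> W" "x' \<in> P + Q" "w' \<in> W"
      and 1: "q (fst (s (q x)) + - r (q w)) = q (fst (s (q x')) + - r (q w'))"
      and 2: "q (r (q w) + snd (s (q x))) = q (r (q w') + snd (s (q x')))"
    have "q (fst (s (q x)) + snd (s (q x))) = q (fst (s (q x')) + snd (s (q x')))"
      using q_add_cong[OF 1 2] by (simp add: algebra_simps)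
    then have e: "q x = q x'"
      using s * by auto
    have "q (- r (q w)) = q (- r (q w'))"
      using 1 e by (simp only: q_add_left_cancel)
    then have "q (r (q w)) = q (r (q w'))"
      using q_uminus_cong[of "- r (q w)"] by simp
    then show "q x = q x' \<and> q w = q w'"
      using e r * by auto
  qed
  moreover have "?g ` (q ` (P + Q) \<times> q ` W) \<subseteq> q ` (P + uminus ` W) \<times> q ` (W + Q)"
  proof clarify
    fix x w assume "x \<in> P + Q" "w \<in> W"
    then have "s (q x) \<in> P \<times> Q" "r (q w) \<in> W"
      using s r by auto
    then show "q (fst (s (q x)) + - r (q w)) \<in> q ` (P + uminus ` W) \<and>
        q (r (q w) + snd (s (q x))) \<in> q ` (W + Q)"
      by (metis imageI mem_Times_iff set_plus_intro)
  qed
  ultimately have "card (q ` (P + Q) \<times> q ` W) \<le> card (q ` (P + uminus ` W) \<times> q ` (W + Q))"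
    using fin by (intro card_inj_on_le) (auto simp: finite_set_plus)
  then show ?thesis
    by (simp add: N_def card_cartesian_product)
qed

section \<open>Pluennecke bounds for several summands\<close>

lemma N_Un_le: "N (X \<union> Y) \<le> N X + N Y"
  by (simp add: N_def image_Un card_Un_le)

text \<open>With the same \<open>X'\<close>, taking \<open>C\<close> to be \<open>{0}\<close>,
  \<open>B\<close> and \<open>B + B\<close> adds the summands one at a time, each at the cost of a
  factor \<open>N (X + B) / N X\<close>.\<close>

lemma pluennecke_triple:
  assumes "finite X" "X \<noteq> {}" "finite B"
  obtains X' where "X' \<subseteq> X" "X' \<noteq> {}"
    "N (X' + B + B + B) * N X ^ 3 \<le> N (X + B) ^ 3 * N X'"
proof -
  obtain X' where X': "X' \<subseteq> X" "X' \<noteq> {}"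
    and pet: "\<And>C. finite C \<Longrightarrow> N (X' + B + C) * N X \<le> N (X + B) * N (X' + C)"
    using petridis[OF assms] by metis
  have 1: "N (X' + B) * N X \<le> N (X + B) * N X'"
    using pet[of "{0}"] by (simp add: N_translate)
  have 2: "N (X' + B + B) * N X \<le> N (X + B) * N (X' + B)"
    using pet[of B] assms by simp
  have 3: "N (X' + B + B + B) * N X \<le> N (X + B) * N (X' + B + B)"
    using pet[of "B + B"] assms by (simp add: finite_set_plus ac_simps)
  have "N (X' + B + B + B) * N X ^ 3 = (N (X' + B + B + B) * N X) * N X ^ 2"
    by (simp add: power_def numeral_eq_Suc ac_simps)
  also have "\<dots> \<le> N (X + B) * N (X' + B + B) * N X ^ 2"
    using 3 by (rule mult_le_mono1)
  also have "\<dots> = N (X + B) * N X * (N (X' + B + B) * N X)"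
    by (simp add: power2_eq_square ac_simps)
  also have "\<dots> \<le> N (X + B) * N X * (N (X + B) * N (X' + B))"
    using 2 by (rule mult_le_mono2)
  also have "\<dots> = N (X + B) ^ 2 * (N (X' + B) * N X)"
    by (simp add: power2_eq_square ac_simps)
  also have "\<dots> \<le> N (X + B) ^ 2 * (N (X + B) * N X')"
    using 1 by (rule mult_le_mono2)
  finally have "N (X' + B + B + B) * N X ^ 3 \<le> N (X + B) ^ 3 * N X'"
    by (simp add: power_def numeral_eq_Suc ac_simps)
  then show thesis
    using that X' by blast
qed

text \<open>The bound is preserved by disjoint unions, so a largest \<open>Z\<close> satisfying it
  is taken. If \<open>Z\<close> were less than half of \<open>X\<close>,
  \<open>pluennecke_triple\<close> applied to \<open>X - Z\<close> would supply a further piece. The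
  factor \<open>8\<close> is the cube of the loss in passing to \<open>X - Z\<close>, which has at
  least half of the points.\<close>

lemma pluennecke_large_subset:
  assumes fin: "finite X" "finite B" and inj: "inj_on q X"
  obtains X' where "X' \<subseteq> X" "card X \<le> 2 * card X'"
    "N (X' + B + B + B) * card X ^ 3 \<le> 8 * N (X + B) ^ 3 * card X'"
proof -
  let ?P = "\<lambda>Z. Z \<subseteq> X \<and> N (Z + B + B + B) * card X ^ 3 \<le> 8 * N (X + B) ^ 3 * card Z"
  have P0: "?P {}" by simp
  have bound: "\<forall>Y. ?P Y \<longrightarrow> card Y < Suc (card X)"
    by (intro allI impI le_imp_less_Suc card_mono fin) (elim conjunct1)
  have "\<exists>Z. ?P Z \<and> (\<forall>Y. ?P Y \<longrightarrow> card Y \<le> card Z)"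
    by (rule ex_has_greatest_nat[of ?P, OF P0 bound])
  then obtain Z where Z: "?P Z" and max: "\<And>Y. ?P Y \<Longrightarrow> card Y \<le> card Z"
    by (elim exE conjE) blast
  have finZ: "finite Z" using Z fin finite_subset by blast
  have card: "N Y = card Y" if "Y \<subseteq> X" for Y
    unfolding N_def using that inj by (intro card_image) (auto intro: inj_on_subset)
  have "card X \<le> 2 * card Z"
  proof (rule ccontr)
    assume small: "\<not> card X \<le> 2 * card Z"
    have cD: "card (X - Z) = card X - card Z"
      using Z finZ by (intro card_Diff_subset) auto
    then have half: "card X \<le> 2 * card (X - Z)"
      using small by linarith
    have ne: "X - Z \<noteq> {}"
      using small half by fastforce
    obtain Y where Y: "Y \<subseteq> X - Z" "Y \<noteq> {}"
      and NY: "N (Y + B + B + B) * N (X - Z) ^ 3 \<le> N (X - Z + B) ^ 3 * N Y"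
      using pluennecke_triple[of "X - Z" B] fin ne by blast
    have finY: "finite Y" using Y fin finite_subset by blast
    have cardX3: "card X ^ 3 \<le> 8 * card (X - Z) ^ 3"
      using power_mono[OF half, of 3] by (simp add: power_mult_distrib)
    have "N (Y + B + B + B) * card X ^ 3 \<le> 8 * (N (Y + B + B + B) * card (X - Z) ^ 3)"
      using mult_le_mono2[OF cardX3, of "N (Y + B + B + B)"] by (simp add: ac_simps)
    also have "\<dots> \<le> 8 * (N (X - Z + B) ^ 3 * card Y)"
      using NY card[of "X - Z"] card[of Y] subset_trans[OF Y(1) Diff_subset]
      by (intro mult_le_mono2) simp
    also have "\<dots> \<le> 8 * (N (X + B) ^ 3 * card Y)"
      by (intro mult_le_mono2 mult_le_mono1 power_mono N_mono set_plus_mono2)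
        (simp_all add: finite_set_plus fin Diff_subset)
    finally have NY': "N (Y + B + B + B) * card X ^ 3 \<le> 8 * N (X + B) ^ 3 * card Y" by simp
    have cU: "card (Z \<union> Y) = card Z + card Y"
      using Y finZ finY by (intro card_Un_disjoint) auto
    have "Z \<union> Y + B + B + B = (Z + B + B + B) \<union> (Y + B + B + B)"
      unfolding set_plus_def by blast
    then have "N (Z \<union> Y + B + B + B) * card X ^ 3
        \<le> (N (Z + B + B + B) + N (Y + B + B + B)) * card X ^ 3"
      using N_Un_le by simp
    also have "\<dots> \<le> 8 * N (X + B) ^ 3 * card (Z \<union> Y)"
      using Z NY' cU by (simp add: algebra_simps)
    finally have "?P (Z \<union> Y)"
      using Z Y by blast
    then have "card (Z \<union> Y) \<le> card Z"
      by (rule max)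
    then show False
      using cU Y finY by simp
  qed
  then show thesis
    using that Z by blast
qed

end

text \<open>Distinct summands \<open>Y\<close> and \<open>Z\<close> reduce to equal ones by placing them on two different axes,
  with multiplicities that make their contributions equal.\<close>

lemma (in add_cong) pluennecke_two_summands:
  assumes fin: "finite X" "finite Y" "finite Z" and ne: "X \<noteq> {}" "Y \<noteq> {}" "Z \<noteq> {}"
  obtains X' where "X' \<subseteq> X" "X' \<noteq> {}"
    "N (X' + Y + Z) * N X ^ 2 \<le> 4 * N (X + Y) * N (X + Z) * N X'"
proof -
  let ?q = "\<lambda>(x :: 'a, v :: int \<times> int). (q x, v)"
  interpret E: add_cong ?q
    by unfold_locales (auto simp: q_add_right_cancel)
  define a b where "a = N (X + Y)" and "b = N (X + Z)"
  have ab: "a > 0" "b > 0"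
    unfolding a_def b_def using fin ne by (auto intro!: N_pos simp: finite_set_plus set_plus_eq_empty)
  have NE: "E.N (V \<times> U) = N V * card U" for V U
  proof -
    have "?q ` (V \<times> U) = q ` V \<times> U" by auto
    then show ?thesis by (simp add: E.N_def N_def card_cartesian_product)
  qed
  \<comment> \<open>\<open>Y\<close> gets \<open>b\<close> copies on the first axis and
    \<open>Z\<close> gets \<open>a\<close> copies on the second, so that each contributes
    \<open>a * b\<close> classes to \<open>X \<times> {0} + B\<close>.\<close>
  define Ia Ib where "Ia = {0..<int b} \<times> {0::int}" and "Ib = {0::int} \<times> {0..<int a}"
  define B where "B = Y \<times> Ia \<union> Z \<times> Ib"
  have finB: "finite B" using fin by (simp add: B_def Ia_def Ib_def)
  have XB: "X \<times> {0} + B = (X + Y) \<times> Ia \<union> (X + Z) \<times> Ib"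
    unfolding B_def set_plus_def by (auto simp: plus_prod_def) force+
  have "E.N (X \<times> {0} + B) \<le> a * b + b * a"
    unfolding XB using E.N_Un_le[of "(X + Y) \<times> Ia" "(X + Z) \<times> Ib"]
    by (simp add: NE a_def[symmetric] b_def[symmetric] Ia_def Ib_def card_cartesian_product)
  then have EB: "E.N (X \<times> {0} + B) \<le> 2 * (a * b)"
    by (simp add: mult.commute)
  obtain V where V: "V \<subseteq> X \<times> {0}" "V \<noteq> {}"
    and pet: "\<And>C. finite C \<Longrightarrow> E.N (V + B + C) * E.N (X \<times> {0}) \<le> E.N (X \<times> {0} + B) * E.N (V + C)"
    using E.petridis[of "X \<times> {0}" B] fin ne finB by (metis Times_empty finite_SigmaI finite.emptyI finite.insertI insert_not_empty)
  define X' where "X' = fst ` V"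
  have VX: "V = X' \<times> {0}"
    using V(1) by (auto simp: X'_def image_iff) force+
  have X': "X' \<subseteq> X" "X' \<noteq> {}"
    using V VX by auto
  have finV: "finite V" using V fin finite_subset by fastforce
  have "E.N (V + B) * N X \<le> E.N (X \<times> {0} + B) * N X'"
    using pet[of "{0}"] by (simp add: E.N_translate VX NE)
  also have "\<dots> \<le> 2 * (a * b) * N X'"
    using EB by (rule mult_le_mono1)
  finally have 1: "E.N (V + B) * N X \<le> 2 * (a * b) * N X'" .
  have "E.N (V + B + B) * N X \<le> E.N (X \<times> {0} + B) * E.N (V + B)"
    using pet[OF finB] by (simp add: NE)
  then have 2: "E.N (V + B + B) * N X \<le> 2 * (a * b) * E.N (V + B)"
    using EB mult_le_mono1 order_trans by blast
  \<comment> \<open>Taking one summand from each axis, every element of \<open>X' + Y + Z\<close>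
    occurs in \<open>V + B + B\<close> with all \<open>a * b\<close> second coordinates.\<close>
  have sub: "(X' + Y + Z) \<times> ({0..<int b} \<times> {0..<int a}) \<subseteq> V + B + B"
  proof clarify
    fix u i j assume u: "u \<in> X' + Y + Z" and ij: "i \<in> {0..<int b}" "j \<in> {0..<int a}"
    then obtain x y z where "u = x + y + z" "x \<in> X'" "y \<in> Y" "z \<in> Z"
      by (auto elim!: set_plus_elim)
    moreover have "(u, i, j) = (x, 0) + (y, i, 0) + (z, 0, j)"
      using calculation by (simp add: zero_prod_def)
    moreover have "(x, 0) \<in> V" "(y, i, 0) \<in> B" "(z, 0, j) \<in> B"
      using calculation ij by (auto simp: VX B_def Ia_def Ib_def)
    ultimately show "(u, i, j) \<in> V + B + B"
      by (metis set_plus_intro)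
  qed
  have "N (X' + Y + Z) * (a * b) \<le> E.N (V + B + B)"
    using E.N_mono[OF _ sub] finV finB by (simp add: NE finite_set_plus card_cartesian_product ac_simps)
  then have "N (X' + Y + Z) * (a * b) * N X ^ 2 \<le> E.N (V + B + B) * N X * N X"
    by (simp add: power2_eq_square mult_le_mono1)
  also have "\<dots> \<le> 2 * (a * b) * E.N (V + B) * N X"
    using 2 by (rule mult_le_mono1)
  also have "\<dots> = 2 * (a * b) * (E.N (V + B) * N X)"
    by simp
  also have "\<dots> \<le> 2 * (a * b) * (2 * (a * b) * N X')"
    using 1 by (rule mult_le_mono2)
  finally have "(a * b) * (N (X' + Y + Z) * N X ^ 2) \<le> (a * b) * (4 * a * b * N X')"
    by (simp add: ac_simps)
  then have "N (X' + Y + Z) * N X ^ 2 \<le> 4 * a * b * N X'"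
    using ab by simp
  then show thesis
    using that X' by (simp add: a_def b_def)
qed

section \<open>The pivot argument in a prime field\<close>

text \<open>Cauchy-Schwarz for the fibre sizes: they add up to \<open>card D\<close>, and their
  squares add up to the number of colliding pairs.\<close>

lemma card_square_le_collisions:
  fixes f :: "'c \<Rightarrow> 'd"
  assumes "finite D"
  shows "card D ^ 2 \<le> card (f ` D) * card {w \<in> D \<times> D. f (fst w) = f (snd w)}"
proof -
  let ?c = "\<lambda>v. card {x \<in> D. f x = v}"
  have "card D = (\<Sum>v\<in>f ` D. ?c v)"
    using sum.image_gen[OF assms, of "\<lambda>_. 1 :: nat" f] by simp
  moreover have "{w \<in> D \<times> D. f (fst w) = f (snd w)}
      = (\<Union>v\<in>f ` D. {x \<in> D. f x = v} \<times> {x \<in> D. f x = v})"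
    by auto
  then have "card {w \<in> D \<times> D. f (fst w) = f (snd w)} = (\<Sum>v\<in>f ` D. ?c v ^ 2)"
    using assms
    by (simp only:) (subst card_UN_disjoint, auto simp: card_cartesian_product power2_eq_square)
  moreover have "(\<Sum>v\<in>f ` D. real (?c v)) ^ 2 \<le> (\<Sum>v\<in>f ` D. real (?c v) ^ 2) * real (card (f ` D))"
    by (rule sum_squared_le_sum_of_squares) 
  ultimately have "real (card D ^ 2) \<le> real (card (f ` D) * card {w \<in> D \<times> D. f (fst w) = f (snd w)})"
    by (simp add: mult.commute)
  then show ?thesis
    by (simp only: of_nat_le_iff)
qed

section \<open>Arithmetic and dilates modulo a prime\<close>

locale prime_mod =
  fixes p :: int
  assumes prime_p: "prime p"
begin

sublocale add_cong "\<lambda>x. x mod p"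
  by unfold_locales (simp add: cong_add_rcancel flip: cong_def)

lemma cong_scale_iff: "\<not> p dvd c \<Longrightarrow> c * x mod p = c * y mod p \<longleftrightarrow> x mod p = y mod p"
  using cong_mult_lcancel[of c p x y] prime_p
  by (metis cong_def coprime_commute prime_imp_coprime)

lemma N_scale: "\<not> p dvd c \<Longrightarrow> N ((*) c ` X) = N X"
  by (simp add: N_image_eq cong_scale_iff)

lemma scale_add: "(*) c ` (X + Y) = (*) c ` X + (*) c ` (Y :: int set)"
proof
  show "(*) c ` X + (*) c ` Y \<subseteq> (*) c ` (X + Y)"
    by (auto elim!: set_plus_elim simp flip: distrib_left)
  show "(*) c ` (X + Y) \<subseteq> (*) c ` X + (*) c ` Y"
    by (auto elim!: set_plus_elim simp: distrib_left intro!: set_plus_intro)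
qed

end

text \<open>For \<open>c\<close> invertible modulo \<open>p\<close> this is the intersection of the
  dilates \<open>c A\<close> and \<open>z A\<close>, divided by \<open>c\<close>. It is kept as a
  subset of \<open>A\<close> because it serves both as a count and as a set of points to be
  dilated.\<close>

definition covers :: "int \<Rightarrow> int set \<Rightarrow> int \<Rightarrow> int \<Rightarrow> int set" where
  "covers p A z c = {a \<in> A. \<exists>u\<in>A. [c * a = z * u] (mod p)}"

lemma covers_subset: "covers p A z c \<subseteq> A"
  by (auto simp: covers_def)

lemma covers_uminus: "covers p A (- z) (- c) = covers p A z c"
  unfolding covers_def by (simp add: cong_minus_minus_iff)

locale residue_set = prime_mod +
  fixes A :: "int set" and s :: int
  assumes A: "A \<subseteq> {1..<p}" and s: "s = 1 \<or> s = - 1"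
begin

lemma finite_A: "finite A"
  using A finite_subset by blast

lemma finite_sub: "X \<subseteq> A \<Longrightarrow> finite X"
  using finite_A finite_subset by blast

lemma mod_id: "a \<in> A \<Longrightarrow> a mod p = a"
  using A by (force intro: mod_pos_pos_trivial)

lemma not_dvd: "a \<in> A \<Longrightarrow> \<not> p dvd a"
  using A zdvd_not_zless[of a p] by force

lemma not_dvd_diff: "a \<in> A \<Longrightarrow> b \<in> A \<Longrightarrow> a \<noteq> b \<Longrightarrow> \<not> p dvd a - b"
  by (metis mod_id mod_eq_dvd_iff)

lemma N_card: "X \<subseteq> A \<Longrightarrow> N X = card X"
  unfolding N_def by (rule card_image, rule inj_onI) (metis mod_id subsetD)

lemma not_dvd_s: "\<not> p dvd s"
  using s prime_p not_prime_unit[of p] by auto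

abbreviation "S \<equiv> N (A + (*) s ` A)"
abbreviation "Q \<equiv> N (A + (*) s ` A + (*) s ` A + (*) s ` A)"

text \<open>A dilate \<open>c Y\<close> with \<open>c A\<close> meeting \<open>z A\<close> in many points may be exchanged for \<open>z A\<close> with
  either sign: one sign comes from the inequality for sums, the other from the one for differences.\<close>

lemma exchange:
  assumes Y: "Y \<subseteq> A" and c: "\<not> p dvd c" and e: "e = z \<or> e = - z" and P: "finite P"
  shows "N (P + (*) c ` Y) * card (covers p A z c) \<le> N (P + (*) e ` A) * S"
proof -
  \<comment> \<open>Modulo \<open>p\<close>, \<open>W\<close> is \<open>s\<close> times the common
    part of \<open>c A\<close> and \<open>z A\<close>. As part of \<open>s c A\<close> it keeps
    \<open>W + c Y\<close> inside \<open>c (A + s A)\<close>; as part of \<open>s z A\<close> it can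
    be enlarged to a full dilate of \<open>A\<close>.\<close>
  define W where "W = (*) (s * c) ` covers p A z c"
  have sc: "\<not> p dvd s * c"
    using c not_dvd_s prime_p prime_dvd_mult_iff by blast
  have fin: "finite W" "finite ((*) c ` Y)"
    using finite_sub[OF Y] finite_sub[OF covers_subset] by (auto simp: W_def)
  have NW: "N W = card (covers p A z c)"
    using N_scale[OF sc] N_card[OF covers_subset] by (simp add: W_def)
  have "W + (*) c ` Y \<subseteq> (*) c ` (A + (*) s ` A)"
    unfolding scale_add image_image W_def using Y covers_subset[of p A z c]
    by (subst add.commute) (intro set_plus_mono2, auto simp: ac_simps)
  then have WY: "N (W + (*) c ` Y) \<le> S"
    using N_mono N_scale[OF c] finite_A by (metis finite_imageI finite_set_plus)
  have qW: "(\<lambda>x. x mod p) ` (*) d ` W \<subseteq> (\<lambda>x. x mod p) ` (*) (d * s * z) ` A" for d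
  proof clarify
    fix w assume "w \<in> W"
    then obtain a u where "w = s * c * a" "u \<in> A" "[c * a = z * u] (mod p)"
      by (auto simp: W_def covers_def)
    then have "[d * w = d * s * z * u] (mod p)"
      using cong_scalar_left[of "c * a" "z * u" p "d * s"] by (simp add: ac_simps)
    then show "d * w mod p \<in> (\<lambda>x. x mod p) ` (*) (d * s * z) ` A"
      using \<open>u \<in> A\<close> by (auto simp: cong_def)
  qed
  have bound: "N (P + (*) d ` W) \<le> N (P + (*) (d * s * z) ` A)" for d
    using qW[of d] P finite_A by (intro N_le q_image_add_mono) (auto simp: finite_set_plus)
  have "N (P + (*) c ` Y) * N W \<le> N (P + (*) e ` A) * N (W + (*) c ` Y)"
  proof (cases "e = s * z")
    case True
    have "N (P + (*) c ` Y) * N W \<le> N (P + W) * N (W + (*) c ` Y)"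
      using P fin by (intro pluennecke_triangle)
    also have "\<dots> \<le> N (P + (*) e ` A) * N (W + (*) c ` Y)"
      using bound[of 1] True by (intro mult_le_mono1) simp
    finally show ?thesis .
  next
    case False
    then have e': "e = - 1 * s * z"
      using e s by auto
    have "N (P + (*) c ` Y) * N W \<le> N (P + uminus ` W) * N (W + (*) c ` Y)"
      using P fin by (intro ruzsa_triangle)
    also have "uminus ` W = (*) (- 1) ` W"
      by (intro image_cong) auto
    also have "N (P + (*) (- 1) ` W) * N (W + (*) c ` Y) \<le> N (P + (*) e ` A) * N (W + (*) c ` Y)"
      using bound[of "- 1"] e' by (intro mult_le_mono1) simp
    finally show ?thesis .
  qed
  also have "\<dots> \<le> N (P + (*) e ` A) * S"
    using WY by (rule mult_le_mono2)
  finally show ?thesis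
    by (simp add: NW)
qed

text \<open>Three uses of \<open>exchange\<close>, all with target \<open>- s * z\<close>; the
  dilate by \<open>- h2\<close> is handled by changing the sign of \<open>z\<close> as well. The
  fourth summand \<open>V\<close> stays open, since it is treated in two different ways
  later.\<close>

lemma exchange3:
  assumes X: "X \<subseteq> A" and Y: "Y \<subseteq> A" and V: "finite V"
    and h: "h1 \<in> A" "h2 \<in> A" and t: "t1 \<in> A"
  shows "N ((*) h1 ` X + (*) (- h2) ` X + (*) t1 ` Y + V)
      * (card (covers p A z h1) * card (covers p A z h2) * card (covers p A z t1))
    \<le> N ((*) (- s * z) ` A + (*) (- s * z) ` A + (*) (- s * z) ` A + V) * S ^ 3"
    (is "N (?X1 + ?X2 + ?Y1 + V) * (?n1 * ?n2 * ?g) \<le> N (?Z + ?Z + ?Z + V) * _")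
proof -
  have fin: "finite ?X1" "finite ?X2" "finite ?Y1" "finite ?Z"
    using finite_sub[OF X] finite_sub[OF Y] finite_A by auto
  have e: "- s * z = z \<or> - s * z = - z" "- s * z = - z \<or> - s * z = - (- z)"
    using s by auto
  have 1: "N (?X2 + ?Y1 + V + ?X1) * ?n1 \<le> N (?X2 + ?Y1 + V + ?Z) * S"
    using fin V h not_dvd by (intro exchange X e) (auto simp: finite_set_plus)
  have "N (?Y1 + V + ?Z + ?X2) * card (covers p A (- z) (- h2)) \<le> N (?Y1 + V + ?Z + ?Z) * S"
    using fin V h not_dvd by (intro exchange X e) (auto simp: finite_set_plus)
  then have 2: "N (?Y1 + V + ?Z + ?X2) * ?n2 \<le> N (?Y1 + V + ?Z + ?Z) * S"
    by (simp add: covers_uminus)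
  have 3: "N (V + ?Z + ?Z + ?Y1) * ?g \<le> N (V + ?Z + ?Z + ?Z) * S"
    using fin V t not_dvd by (intro exchange Y e) (auto simp: finite_set_plus)
  have "N (?X1 + ?X2 + ?Y1 + V) * (?n1 * ?n2 * ?g) = N (?X2 + ?Y1 + V + ?X1) * ?n1 * (?n2 * ?g)"
    by (simp add: ac_simps)
  also have "\<dots> \<le> N (?X2 + ?Y1 + V + ?Z) * S * (?n2 * ?g)"
    using 1 by (rule mult_le_mono1)
  also have "\<dots> = N (?Y1 + V + ?Z + ?X2) * ?n2 * (S * ?g)"
    by (simp add: ac_simps)
  also have "\<dots> \<le> N (?Y1 + V + ?Z + ?Z) * S * (S * ?g)"
    using 2 by (rule mult_le_mono1)
  also have "\<dots> = N (V + ?Z + ?Z + ?Y1) * ?g * (S * S)"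
    by (simp add: ac_simps)
  also have "\<dots> \<le> N (V + ?Z + ?Z + ?Z) * S * (S * S)"
    using 3 by (rule mult_le_mono1)
  also have "\<dots> = N (?Z + ?Z + ?Z + V) * S ^ 3"
    by (simp add: ac_simps power3_eq_cube)
  finally show ?thesis .
qed

text \<open>This is \<open>Q\<close> dilated by the unit \<open>- z\<close>; it explains why three
  exchanges aim at \<open>- s * z\<close> and the last one at \<open>- z\<close>.\<close>

lemma N_four:
  assumes z: "\<not> p dvd z"
  shows "N ((*) (- s * z) ` A + (*) (- s * z) ` A + (*) (- s * z) ` A + (*) (- z) ` A) = Q"
proof -
  have "N ((*) (- z) ` (A + (*) s ` A + (*) s ` A + (*) s ` A)) = Q"
    using z by (intro N_scale) auto
  moreover have "(*) (- z) ` (*) s ` A = (*) (- s * z) ` A"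
    by (simp add: image_image ac_simps)
  ultimately show ?thesis
    by (simp only: scale_add ac_simps)
qed

lemma dilate_diff_subset:
  "(*) (h1 - h2) ` X + (*) (t1 - t2) ` (Y :: int set)
    \<subseteq> (*) h1 ` X + (*) (- h2) ` X + (*) t1 ` Y + (*) (- t2) ` Y"
proof -
  have "(*) (a - b) ` Z \<subseteq> (*) a ` Z + (*) (- b) ` (Z :: int set)" for a b Z
  proof clarify
    fix x assume "x \<in> Z"
    then have "a * x + - b * x \<in> (*) a ` Z + (*) (- b) ` Z"
      by blast
    then show "(a - b) * x \<in> (*) a ` Z + (*) (- b) ` Z"
      by (simp add: left_diff_distrib)
  qed
  then have "(*) (h1 - h2) ` X + (*) (t1 - t2) ` Y
      \<subseteq> ((*) h1 ` X + (*) (- h2) ` X) + ((*) t1 ` Y + (*) (- t2) ` Y)"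
    by (intro set_plus_mono2)
  then show ?thesis
    by (simp add: ac_simps)
qed

text \<open>Modulo \<open>p\<close>, \<open>t2 Y\<close> already lies in \<open>z A\<close>, so the
  fourth dilate is replaced without an exchange and only \<open>S ^ 3\<close> is paid.\<close>

lemma dilates_bound_covered:
  assumes X: "X \<subseteq> A" and Y: "Y \<subseteq> covers p A z t2"
    and h: "h1 \<in> A" "h2 \<in> A" and t: "t1 \<in> A" and z: "\<not> p dvd z"
  shows "N ((*) (h1 - h2) ` X + (*) (t1 - t2) ` Y)
      * (card (covers p A z h1) * card (covers p A z h2) * card (covers p A z t1)) \<le> Q * S ^ 3"
proof -
  let ?V = "(*) (- t2) ` Y" and ?Z = "(*) (- s * z) ` A" and ?Z' = "(*) (- z) ` A"
  let ?m = "card (covers p A z h1) * card (covers p A z h2) * card (covers p A z t1)"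
  have YA: "Y \<subseteq> A"
    using Y covers_subset by blast
  note fin = finite_sub[OF X] finite_sub[OF YA] finite_A
  have "N ((*) (h1 - h2) ` X + (*) (t1 - t2) ` Y) \<le> N ((*) h1 ` X + (*) (- h2) ` X + (*) t1 ` Y + ?V)"
    using fin by (intro N_mono dilate_diff_subset) (auto simp: finite_set_plus)
  then have "N ((*) (h1 - h2) ` X + (*) (t1 - t2) ` Y) * ?m \<le> N (?Z + ?Z + ?Z + ?V) * S ^ 3"
    using exchange3[OF X YA _ h t, of ?V z] fin mult_le_mono1 order_trans by blast
  also have "N (?Z + ?Z + ?Z + ?V) \<le> N (?Z + ?Z + ?Z + ?Z')"
  proof (intro N_le q_image_add_mono subset_refl)
    show "(\<lambda>x. x mod p) ` ?V \<subseteq> (\<lambda>x. x mod p) ` ?Z'"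
    proof clarify
      fix y assume "y \<in> Y"
      then obtain u where u: "u \<in> A" "[t2 * y = z * u] (mod p)"
        using Y by (auto simp: covers_def)
      then have "[- t2 * y = - z * u] (mod p)"
        by (simp add: cong_minus_minus_iff)
      then show "- t2 * y mod p \<in> (\<lambda>x. x mod p) ` ?Z'"
        using u(1) by (auto simp: cong_def)
    qed
  qed (use fin in \<open>auto simp: finite_set_plus\<close>)
  finally show ?thesis
    using N_four[OF z] by (simp add: mult_le_mono1)
qed

text \<open>For general \<open>Y\<close> the dilate by \<open>- t2\<close> needs a fourth exchange,
  hence the additional factors \<open>S\<close> and \<open>?g\<close>.\<close>

lemma dilates_bound:
  assumes X: "X \<subseteq> A" and Y: "Y \<subseteq> A"
    and h: "h1 \<in> A" "h2 \<in> A" and t: "t1 \<in> A" "t2 \<in> A" and z: "\<not> p dvd z"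
  shows "N ((*) (h1 - h2) ` X + (*) (t1 - t2) ` Y)
      * (card (covers p A z h1) * card (covers p A z h2) * card (covers p A z t1) * card (covers p A z t2))
    \<le> Q * S ^ 4"
proof -
  let ?V = "(*) (- t2) ` Y" and ?Z = "(*) (- s * z) ` A" and ?Z' = "(*) (- z) ` A"
  let ?m = "card (covers p A z h1) * card (covers p A z h2) * card (covers p A z t1)"
    and ?g = "card (covers p A z t2)"
  note fin = finite_sub[OF X] finite_sub[OF Y] finite_A
  have "N ((*) (h1 - h2) ` X + (*) (t1 - t2) ` Y) \<le> N ((*) h1 ` X + (*) (- h2) ` X + (*) t1 ` Y + ?V)"
    using fin by (intro N_mono dilate_diff_subset) (auto simp: finite_set_plus)
  then have 1: "N ((*) (h1 - h2) ` X + (*) (t1 - t2) ` Y) * ?m \<le> N (?Z + ?Z + ?Z + ?V) * S ^ 3"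
    using exchange3[OF X Y _ h t(1), of ?V z] fin mult_le_mono1 order_trans by blast
  have "N (?Z + ?Z + ?Z + ?V) * card (covers p A (- z) (- t2)) \<le> N (?Z + ?Z + ?Z + ?Z') * S"
    using fin t not_dvd by (intro exchange Y) (auto simp: finite_set_plus)
  then have 2: "N (?Z + ?Z + ?Z + ?V) * ?g \<le> Q * S"
    unfolding covers_uminus N_four[OF z] .
  have "N ((*) (h1 - h2) ` X + (*) (t1 - t2) ` Y) * (?m * ?g)
      = N ((*) (h1 - h2) ` X + (*) (t1 - t2) ` Y) * ?m * ?g"
    by simp
  also have "\<dots> \<le> N (?Z + ?Z + ?Z + ?V) * S ^ 3 * ?g"
    using 1 by (rule mult_le_mono1)
  also have "\<dots> = N (?Z + ?Z + ?Z + ?V) * ?g * S ^ 3"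
    by simp
  also have "\<dots> \<le> Q * S * S ^ 3"
    using 2 by (rule mult_le_mono1)
  finally show ?thesis
    by (simp add: power_def numeral_eq_Suc ac_simps)
qed

text \<open>The slope \<open>(t1 - t2) / (h1 - h2)\<close> with the denominator cleared.\<close>

definition slope :: "int set \<Rightarrow> int set \<Rightarrow> int \<Rightarrow> bool" where
  "slope T H r \<longleftrightarrow> (\<exists>t1\<in>T. \<exists>t2\<in>T. \<exists>h1\<in>H. \<exists>h2\<in>H. h1 \<noteq> h2 \<and> [(h1 - h2) * r = t1 - t2] (mod p))"

lemma not_slopeD:
  assumes "\<not> slope T H r" "x \<in> T" "x' \<in> T" "y \<in> H" "y' \<in> H"
    and eq: "(x + r * y) mod p = (x' + r * y') mod p"
  shows "y = y'"
proof (rule ccontr)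
  assume "y \<noteq> y'"
  have "[(y - y') * r = x' - x] (mod p)"
    using eq unfolding mod_eq_dvd_iff cong_iff_dvd_diff by (simp add: algebra_simps)
  then show False
    using assms \<open>y \<noteq> y'\<close> unfolding slope_def by blast
qed

text \<open>A coincidence \<open>x + r * y = x' + r * y'\<close> modulo \<open>p\<close> with
  distinct \<open>y\<close> and \<open>y'\<close> would make \<open>r\<close> a slope, so all these
  sums are in different classes.\<close>

lemma N_not_slope:
  assumes "\<not> slope T H r" and X: "X \<subseteq> T" "T \<subseteq> A" and Y: "Y \<subseteq> H"
  shows "N (X + (*) r ` Y) = card X * card Y"
proof -
  have "inj_on (\<lambda>(x, y). (x + r * y) mod p) (X \<times> Y)"
  proof (rule inj_onI, clarify)
    fix x y x' y'
    assume *: "x \<in> X" "y \<in> Y" "x' \<in> X" "y' \<in> Y" "(x + r * y) mod p = (x' + r * y') mod p"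
    then have "y = y'"
      using not_slopeD[OF assms(1)] X Y by blast
    then have "x mod p = x' mod p"
      using * q_add_right_cancel by simp
    then show "x = x' \<and> y = y'"
      using * X mod_id \<open>y = y'\<close> by (metis subsetD)
  qed
  moreover have "(\<lambda>x. x mod p) ` (X + (*) r ` Y) = (\<lambda>(x, y). (x + r * y) mod p) ` (X \<times> Y)"
    unfolding set_plus_def by (auto simp: image_iff)
  ultimately show ?thesis
    unfolding N_def by (simp add: card_image card_cartesian_product)
qed

text \<open>Zero is a slope, because the numerator may be \<open>t - t\<close>, and steps of size
  \<open>s\<close> reach every residue class from there.\<close>

lemma slope_all:
  assumes step: "\<And>r. slope T H r \<Longrightarrow> slope T H (r + s)"
    and T: "t \<in> T" and H: "h1 \<in> H" "h2 \<in> H" "h1 \<noteq> h2"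
  shows "slope T H r"
proof -
  have multiples: "slope T H (int k * s)" for k
  proof (induction k)
    case 0
    have "[(h1 - h2) * (int 0 * s) = t - t] (mod p)"
      by simp
    then show ?case
      using T H unfolding slope_def by blast
  next
    case (Suc k)
    have "int (Suc k) * s = int k * s + s"
      by (simp add: algebra_simps)
    then show ?case
      using step[OF Suc] by (simp only:)
  qed
  \<comment> \<open>Since \<open>s * s = 1\<close>, this number of steps of size \<open>s\<close>
    leads from \<open>0\<close> to \<open>r\<close> modulo \<open>p\<close>.\<close>
  define k where "k = nat (s * r mod p)"
  have "int k = s * r mod p"
    using prime_p by (simp add: k_def prime_gt_0_int)
  then have "[int k * s = s * r * s] (mod p)"
    by (simp add: cong_def mod_mult_left_eq)
  then have "[int k * s = r] (mod p)"
    using s by auto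
  then have cong: "[(a - b) * (int k * s) = (a - b) * r] (mod p)" for a b
    by (rule cong_scalar_left)
  show ?thesis
    using multiples[of k] unfolding slope_def by (meson cong cong_sym cong_trans)
qed

text \<open>Two distinct points of \<open>T \<times> H\<close> lie on a common line \<open>x + r y = const\<close> for at most one \<open>r\<close>, so
  some direction \<open>r\<close> has few collisions.\<close>

lemma exists_large_projection:
  assumes T: "T \<subseteq> A" and H: "H \<subseteq> A" and small: "int (card T * card H) \<le> p"
  obtains r where "card T * card H \<le> 2 * N (T + (*) r ` H)"
proof -
  define D where "D = T \<times> H"
  define f where "f r = (\<lambda>(x, y). (x + r * y) mod p)" for r
  define E where "E r = {w \<in> D \<times> D. f r (fst w) = f r (snd w)}" for r
  have finD: "finite D"
    using finite_sub T H by (simp add: D_def)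
  have cardD: "card D = card T * card H"
    by (simp add: D_def card_cartesian_product)
  have p0: "p > 0"
    using prime_p prime_gt_0_int by blast
  have one: "card {r \<in> {0..<p}. f r u = f r v} \<le> (if u = v then nat p else 1)"
    if uv: "u \<in> D" "v \<in> D" for u v
  proof (cases "u = v")
    case True
    have "card {r \<in> {0..<p}. f r u = f r v} \<le> card {0..<p}"
      by (intro card_mono) auto
    then show ?thesis
      using True by simp
  next
    case False
    obtain t h t' h' where eqs: "u = (t, h)" "v = (t', h')"
      by (cases u, cases v)
    have mem: "t \<in> A" "t' \<in> A" "h \<in> A" "h' \<in> A"
      using uv T H by (auto simp: eqs D_def)
    have "r = r'" if r: "r \<in> {0..<p}" "f r u = f r v" and r': "r' \<in> {0..<p}" "f r' u = f r' v" for r r'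
    proof -
      have d: "p dvd (t - t') + r * (h - h')" "p dvd (t - t') + r' * (h - h')"
        using r(2) r'(2) by (simp_all add: f_def eqs mod_eq_dvd_iff algebra_simps)
      have "h \<noteq> h'"
        using d(1) not_dvd_diff[of t t'] mem False by (auto simp: eqs)
      then have "\<not> p dvd h - h'"
        using not_dvd_diff mem by blast
      moreover have "p dvd (r - r') * (h - h')"
        using dvd_diff[OF d] by (simp add: algebra_simps)
      ultimately have "r mod p = r' mod p"
        using prime_p by (simp add: prime_dvd_mult_iff mod_eq_dvd_iff)
      then show ?thesis
        using r(1) r'(1) by simp
    qed
    then have "\<forall>r\<in>{r \<in> {0..<p}. f r u = f r v}. \<forall>r'\<in>{r \<in> {0..<p}. f r u = f r v}. r = r'"
      by blast
    moreover have "finite {r \<in> {0..<p}. f r u = f r v}"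
      by (intro finite_Collect_conjI disjI1) simp
    ultimately have "card {r \<in> {0..<p}. f r u = f r v} \<le> 1"
      unfolding One_nat_def using card_le_Suc0_iff_eq by blast
    then show ?thesis
      using False by simp
  qed
  have "(\<Sum>r\<in>{0..<p}. card (E r)) = (\<Sum>r\<in>{0..<p}. \<Sum>w\<in>D \<times> D. if f r (fst w) = f r (snd w) then 1 else 0)"
    unfolding E_def using finD
    by (intro sum.cong refl) (simp add: sum.If_cases Int_def)
  also have "\<dots> = (\<Sum>w\<in>D \<times> D. card {r \<in> {0..<p}. f r (fst w) = f r (snd w)})"
    by (subst sum.swap) (simp add: sum.If_cases Int_def)
  also have "\<dots> \<le> (\<Sum>w\<in>D \<times> D. if fst w = snd w then nat p else 1)"
    by (intro sum_mono one) (simp_all only: mem_Times_iff)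
  also have "\<dots> \<le> (\<Sum>w\<in>D \<times> D. (if fst w = snd w then nat p else 0) + 1)"
    by (intro sum_mono) auto
  also have "\<dots> = card D * nat p + card D ^ 2"
  proof -
    have "{w \<in> D \<times> D. fst w = snd w} = (\<lambda>u. (u, u)) ` D"
      by auto
    then have "card {w \<in> D \<times> D. fst w = snd w} = card D"
      by (simp add: card_image inj_on_def)
    then show ?thesis
      unfolding sum.distrib using finD
      by (simp add: sum.If_cases Int_def card_cartesian_product power2_eq_square)
  qed
  \<comment> \<open>The first term counts the diagonal, where all directions collide; it dominates
    because \<open>card D\<close> is at most \<open>p\<close>.\<close>
  also have "\<dots> \<le> 2 * card D * nat p"
  proof -
    have "card D \<le> nat p"
      using nat_mono[OF small] by (simp only: nat_int cardD)
    then show ?thesis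
      using mult_le_mono2[of "card D" "nat p" "card D"] by (simp add: power2_eq_square)
  qed
  finally have total: "(\<Sum>r\<in>{0..<p}. card (E r)) \<le> 2 * card D * nat p" .
  obtain r where r: "card (E r) \<le> 2 * card D"
  proof (rule ccontr)
    assume "\<not> thesis"
    then have "Suc (2 * card D) \<le> card (E r)" for r
      using that by (meson not_less_eq_eq)
    then have "(\<Sum>r\<in>{0..<p}. Suc (2 * card D)) \<le> (\<Sum>r\<in>{0..<p}. card (E r))"
      by (intro sum_mono)
    then have "Suc (2 * card D) * nat p \<le> 2 * card D * nat p"
      using total by (simp add: mult.commute)
    then show False
      using p0 by simp
  qed
  have "(\<lambda>x. x mod p) ` (T + (*) r ` H) = f r ` D"
    unfolding set_plus_def f_def D_def by (auto simp: image_iff)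
  then have "card D ^ 2 \<le> N (T + (*) r ` H) * card (E r)"
    using card_square_le_collisions[OF finD, of "f r"] by (simp add: N_def E_def)
  also have "\<dots> \<le> N (T + (*) r ` H) * (2 * card D)"
    using r by (rule mult_le_mono2)
  finally have "card D * card D \<le> card D * (2 * N (T + (*) r ` H))"
    by (simp add: power2_eq_square ac_simps)
  then have "card D \<le> 2 * N (T + (*) r ` H)"
    by auto
  then show thesis
    using that cardD by simp
qed

text \<open>Clearing the denominator: dilation by the unit \<open>d\<close> keeps the number of
  classes and turns \<open>r\<close> into \<open>e\<close>.\<close>

lemma N_slope_dilate:
  assumes "\<not> p dvd d" "[d * r = e] (mod p)"
  shows "N (X + (*) r ` Y) = N ((*) d ` X + (*) e ` Y)"
proof -
  have "(\<lambda>x. x mod p) ` (*) d ` (*) r ` Y = (\<lambda>x. x mod p) ` (*) e ` Y"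
    unfolding image_image
  proof (intro image_cong refl)
    fix y
    show "d * (r * y) mod p = e * y mod p"
      using cong_scalar_right[OF assms(2), of y] by (simp add: cong_def mult.assoc)
  qed
  then have "(\<lambda>x. x mod p) ` ((*) d ` X + (*) d ` (*) r ` Y) = (\<lambda>x. x mod p) ` ((*) d ` X + (*) e ` Y)"
    by (intro equalityI q_image_add_mono) auto
  then have "N ((*) d ` (X + (*) r ` Y)) = N ((*) d ` X + (*) e ` Y)"
    by (simp add: N_def scale_add)
  then show ?thesis
    using N_scale[OF assms(1)] by simp
qed

section \<open>The pivot inequality\<close>

lemma card_le_S: "card A \<le> S"
proof (cases "A = {}")
  case False
  then obtain a where "a \<in> A" by blast
  have "card A = N (A + {s * a})"
    by (simp add: N_translate N_card)
  also have "\<dots> \<le> S"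
    using \<open>a \<in> A\<close> finite_A by (intro N_mono set_plus_mono2) (auto simp: finite_set_plus)
  finally show ?thesis .
qed simp

text \<open>The case where every residue is a slope bounds \<open>card T * card H\<close>, the other
  case bounds \<open>card T ^ 2\<close>; the minimum accommodates both. In the second case one
  factor \<open>g\<close> is the size of the set \<open>Y\<close>, and the other comes from
  exchanging the dilate by \<open>t1\<close>.\<close>

lemma pivot:
  assumes T: "T \<subseteq> A" and H: "H \<subseteq> A" and z: "\<not> p dvd z" and small: "int (card A ^ 2) \<le> p"
    and n: "\<And>h. h \<in> H \<Longrightarrow> n \<le> card (covers p A z h)"
    and g: "\<And>t. t \<in> T \<Longrightarrow> g \<le> card (covers p A z t \<inter> H)"
  shows "g ^ 2 * n ^ 2 * card T * min (card T) (card H) \<le> 4 * S ^ 4 * Q"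
proof (cases "card H \<le> 1 \<or> T = {}")
  \<comment> \<open>A nonzero denominator \<open>h1 - h2\<close> requires two points of
    \<open>H\<close>. With a single one, \<open>g \<le> 1\<close> and the trivial bounds by
    \<open>S\<close> suffice.\<close>
  case True
  show ?thesis
  proof (cases "T = {} \<or> H = {}")
    case False
    then obtain t h where th: "t \<in> T" "h \<in> H" by blast
    have 1: "card H = 1"
      using True False finite_sub[OF H] by (metis card_0_eq le_antisym less_one not_le)
    have "g \<le> card H"
      using g[OF th(1)] card_mono[OF finite_sub[OF H], of "covers p A z t \<inter> H"] by simp
    then have g1: "g \<le> 1"
      using 1 by simp
    have "n \<le> card A"
      using n[OF th(2)] card_mono[OF finite_A covers_subset] order_trans by blast
    then have nS: "n \<le> S"
      using card_le_S by simp
    have TS: "card T \<le> S"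
      using card_le_S card_mono[OF finite_A T] by simp
    have S1: "1 \<le> S"
      using TS th(1) finite_sub[OF T] by (metis One_nat_def Suc_leI card_gt_0_iff empty_iff less_le_trans)
    have "A \<noteq> {}"
      using th T by blast
    then have Q1: "1 \<le> Q"
      unfolding One_nat_def by (intro Suc_leI N_pos) (simp_all add: finite_set_plus finite_A set_plus_eq_empty)
    have "g ^ 2 * n ^ 2 * card T * min (card T) (card H) \<le> 1 ^ 2 * S ^ 2 * S * S"
      using g1 nS TS 1 S1 by (intro mult_le_mono power_mono) auto
    also have "\<dots> = S ^ 4 * 1"
      by (simp add: power_def numeral_eq_Suc)
    also have "\<dots> \<le> 4 * S ^ 4 * Q"
      using Q1 by (intro mult_le_mono) auto
    finally show ?thesis .
  qed auto
next
  case False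
  obtain h1 h2 where h12: "h1 \<in> H" "h2 \<in> H" "h1 \<noteq> h2"
    using False finite_sub[OF H] card_le_Suc0_iff_eq[of H] by (metis One_nat_def)
  obtain t0 where t0: "t0 \<in> T" using False by blast
  have g': "g \<le> card (covers p A z t)" if "t \<in> T" for t
    using g[OF that] card_mono[of "covers p A z t" "covers p A z t \<inter> H"] finite_sub[OF covers_subset]
    by (meson Int_lower1 order_trans)
  show ?thesis
  proof (cases "\<forall>r. slope T H r \<longrightarrow> slope T H (r + s)")
    \<comment> \<open>By \<open>slope_all\<close> every residue is a slope, in particular the
      direction of a large projection; the sum is then bounded by four exchanges.\<close>
    case True
    have "card T * card H \<le> card A * card A"
      using T H finite_A by (intro mult_le_mono card_mono)
    then have "int (card T * card H) \<le> p"
      using small by (simp add: power2_eq_square flip: of_nat_mult)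
    then obtain r where r: "card T * card H \<le> 2 * N (T + (*) r ` H)"
      using exists_large_projection[OF T H] by blast
    have "slope T H r"
      using slope_all True t0 h12 by blast
    then obtain t1 t2 k1 k2 where t: "t1 \<in> T" "t2 \<in> T" and k: "k1 \<in> H" "k2 \<in> H" "k1 \<noteq> k2"
      and eq: "[(k1 - k2) * r = t1 - t2] (mod p)"
      unfolding slope_def by blast
    have mem: "t1 \<in> A" "t2 \<in> A" "k1 \<in> A" "k2 \<in> A"
      using t k T H by auto
    let ?U = "N ((*) (k1 - k2) ` T + (*) (t1 - t2) ` H)"
    have U: "N (T + (*) r ` H) = ?U"
      using not_dvd_diff[of k1 k2] mem k(3) eq by (intro N_slope_dilate) auto
    have "g ^ 2 * n ^ 2 * card T * min (card T) (card H) \<le> g ^ 2 * n ^ 2 * (card T * card H)"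
      by (simp add: mult.assoc)
    also have "\<dots> \<le> g ^ 2 * n ^ 2 * (2 * ?U)"
      using r U by (intro mult_le_mono2) simp
    also have "\<dots> = 2 * (?U * (n * n * g * g))"
      by (simp add: power2_eq_square)
    also have "\<dots> \<le> 2 * (?U * (card (covers p A z k1) * card (covers p A z k2)
        * card (covers p A z t1) * card (covers p A z t2)))"
      using n k g' t by (intro mult_le_mono order_refl) auto
    also have "\<dots> \<le> 2 * (Q * S ^ 4)"
      using mem by (intro mult_le_mono2 dilates_bound T H z)
    also have "\<dots> \<le> 4 * S ^ 4 * Q"
      by simp
    finally show ?thesis .
  next
    case False
    then obtain r where "slope T H r" and ns: "\<not> slope T H (r + s)"
      by blast
    then obtain t1 t2 k1 k2 where t: "t1 \<in> T" "t2 \<in> T" and k: "k1 \<in> H" "k2 \<in> H" "k1 \<noteq> k2"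
      and eq: "[(k1 - k2) * r = t1 - t2] (mod p)"
      unfolding slope_def by blast
    have mem: "t1 \<in> A" "t2 \<in> A" "k1 \<in> A" "k2 \<in> A"
      using t k T H by auto
    \<comment> \<open>Membership in \<open>covers p A z t2\<close> saves an exchange, membership in
      \<open>H\<close> allows \<open>r + s\<close> to be used as a non-slope, and at least
      \<open>g\<close> points remain.\<close>
    define Y where "Y = covers p A z t2 \<inter> H"
    have Y: "Y \<subseteq> covers p A z t2" "Y \<subseteq> H" "Y \<subseteq> A"
      using H by (auto simp: Y_def)
    have gY: "g \<le> card Y"
      using g[OF t(2)] by (simp add: Y_def)
    let ?U = "N ((*) (k1 - k2) ` T + (*) (t1 - t2) ` Y)"
    have U: "N (T + (*) r ` Y) = ?U"
      using not_dvd_diff[of k1 k2] mem k(3) eq by (intro N_slope_dilate) auto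
    \<comment> \<open>\<open>X + (r + s) Y\<close> has full size \<open>card X * card Y\<close> and
      lies in \<open>X + s Y + r Y\<close>, which \<open>pluennecke_two_summands\<close> bounds
      proportionally to \<open>card X\<close>. The unknown \<open>card X\<close> then
      cancels.\<close>
    have YT: "card Y * card T ^ 2 \<le> 4 * S * ?U"
    proof (cases "Y = {}")
      case False
      obtain X where X: "X \<subseteq> T" "X \<noteq> {}"
        and NX: "N (X + (*) s ` Y + (*) r ` Y) * N T ^ 2 \<le> 4 * N (T + (*) s ` Y) * N (T + (*) r ` Y) * N X"
        using pluennecke_two_summands[of T "(*) s ` Y" "(*) r ` Y"] finite_sub T Y(3) t0 False
        by (metis empty_iff finite_imageI image_is_empty)
      have finX: "finite X" "finite Y"
        using X T Y finite_sub by auto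
      have "X + (*) (r + s) ` Y \<subseteq> X + (*) s ` Y + (*) r ` Y"
      proof
        fix u assume "u \<in> X + (*) (r + s) ` Y"
        then obtain x y where "u = x + (r + s) * y" "x \<in> X" "y \<in> Y"
          by (auto elim!: set_plus_elim)
        then have "u = (x + s * y) + r * y" "x \<in> X" "y \<in> Y"
          by (auto simp: algebra_simps)
        then show "u \<in> X + (*) s ` Y + (*) r ` Y"
          by blast
      qed
      then have "card X * card Y \<le> N (X + (*) s ` Y + (*) r ` Y)"
        using N_mono[of "X + (*) s ` Y + (*) r ` Y" "X + (*) (r + s) ` Y"]
          N_not_slope[OF ns X(1) T Y(2)] finX by (simp add: finite_set_plus)
      then have "card X * card Y * card T ^ 2 \<le> N (X + (*) s ` Y + (*) r ` Y) * card T ^ 2"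
        by (rule mult_le_mono1)
      also have "\<dots> \<le> 4 * N (T + (*) s ` Y) * ?U * card X"
        using NX by (simp only: N_card[OF T] N_card[OF subset_trans[OF X(1) T]] U)
      finally have "card X * (card Y * card T ^ 2) \<le> card X * (4 * N (T + (*) s ` Y) * ?U)"
        by (simp add: ac_simps)
      then have "card Y * card T ^ 2 \<le> 4 * N (T + (*) s ` Y) * ?U"
        using X finX by (simp add: card_gt_0_iff)
      also have "N (T + (*) s ` Y) \<le> S"
        using T Y(3) finite_A by (intro N_mono set_plus_mono2 image_mono) (simp_all add: finite_set_plus)
      finally show ?thesis
        by (simp add: mult_le_mono1)
    qed simp
    have "g ^ 2 * n ^ 2 * card T * min (card T) (card H) \<le> g ^ 2 * n ^ 2 * card T * card T"
      by (intro mult_le_mono2) simp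
    also have "\<dots> = g * card T ^ 2 * (n * n * g)"
      by (simp add: power2_eq_square)
    also have "\<dots> \<le> card Y * card T ^ 2 * (n * n * g)"
      using gY by (intro mult_le_mono1)
    also have "\<dots> \<le> 4 * S * ?U * (n * n * g)"
      using YT by (rule mult_le_mono1)
    also have "\<dots> = 4 * S * (?U * (n * n * g))"
      by simp
    also have "\<dots> \<le> 4 * S * (?U * (card (covers p A z k1) * card (covers p A z k2) * card (covers p A z t1)))"
      using n k g' t by (intro mult_le_mono order_refl) auto
    also have "\<dots> \<le> 4 * S * (Q * S ^ 3)"
      using mem Y(1) by (intro mult_le_mono2 dilates_bound_covered T z)
    also have "\<dots> = 4 * S ^ 4 * Q"
      by (simp add: power4_eq_xxxx power3_eq_cube)
    finally show ?thesis .
  qed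
qed

end

section \<open>Vertices with many popular neighbours\<close>

lemma sum_card_swap:
  assumes "finite A" "finite B"
  shows "(\<Sum>a\<in>A. card {b \<in> B. R a b}) = (\<Sum>b\<in>B. card {a \<in> A. R a b})"
proof -
  have "(\<Sum>a\<in>A. \<Sum>b\<in>B. if R a b then 1 else 0 :: nat) = (\<Sum>b\<in>B. \<Sum>a\<in>A. if R a b then 1 else 0)"
    by (rule sum.swap)
  then show ?thesis
    using assms by (simp add: sum.If_cases Int_def)
qed

lemma exists_ge_average:
  fixes f :: "'a \<Rightarrow> real"
  assumes "finite A" "A \<noteq> {}"
  obtains x where "x \<in> A" "sum f A \<le> real (card A) * f x"
  using sum_bounded_above_strict[of A f "sum f A / real (card A)"] assms
  by (force simp: field_simps card_gt_0_iff not_less)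

lemma harm_le_one_plus_ln: "0 < n \<Longrightarrow> harm n \<le> 1 + ln (real n)"
  using euler_mascheroni_sequence_decreasing[of 1 n] by (simp add: harm_expand)

text \<open>The sum of \<open>f\<close> is the sum of its level counts \<open>c v\<close>. Levels up
  to \<open>\<tau>\<close> account for at most \<open>card A * \<tau>\<close>. If
  \<open>v * c v\<close> were below \<open>D / harm m\<close> at every higher level, these levels
  would add up to less than \<open>D\<close>.\<close>

lemma exists_heavy_level:
  fixes f :: "'a \<Rightarrow> nat" and \<tau> :: real
  assumes fin: "finite A" and f: "\<And>a. a \<in> A \<Longrightarrow> f a \<le> m"
    and \<tau>: "0 \<le> \<tau>" "real (card A) * \<tau> < real (\<Sum>a\<in>A. f a)"
  obtains v where "\<tau> < real v"
    "real (\<Sum>a\<in>A. f a) - real (card A) * \<tau> \<le> harm m * real (v * card {a \<in> A. v \<le> f a})"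
proof -
  define c where "c v = card {a \<in> A. v \<le> f a}" for v
  define D where "D = real (\<Sum>a\<in>A. f a) - real (card A) * \<tau>"
  have D: "D > 0"
    using \<tau> by (simp add: D_def)
  have "(\<Sum>a\<in>A. f a) = (\<Sum>a\<in>A. card {v \<in> {1..m}. v \<le> f a})"
  proof (intro sum.cong refl)
    fix a assume "a \<in> A"
    then have "{v \<in> {1..m}. v \<le> f a} = {1..f a}"
      using f by fastforce
    then show "f a = card {v \<in> {1..m}. v \<le> f a}"
      by simp
  qed
  also have "\<dots> = (\<Sum>v\<in>{1..m}. c v)"
    unfolding c_def using fin by (rule sum_card_swap) simp
  finally have layers: "(\<Sum>a\<in>A. f a) = (\<Sum>v\<in>{1..m}. c v)" .
  let ?lo = "{v \<in> {1..m}. real v \<le> \<tau>}" and ?hi = "{v \<in> {1..m}. \<tau> < real v}"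
  have split: "(\<Sum>v\<in>{1..m}. real (c v)) = (\<Sum>v\<in>?lo. real (c v)) + (\<Sum>v\<in>?hi. real (c v))"
    by (subst sum.union_disjoint[symmetric]) (auto intro!: sum.cong)
  have "?lo \<subseteq> {1..nat \<lfloor>\<tau>\<rfloor>}"
    by (auto simp: le_nat_floor)
  then have "card ?lo \<le> nat \<lfloor>\<tau>\<rfloor>"
    using card_mono[of "{1..nat \<lfloor>\<tau>\<rfloor>}" ?lo] by simp
  then have lo: "real (card ?lo) \<le> \<tau>"
    using \<tau> by (simp add: le_nat_iff le_floor_iff)
  have "(\<Sum>v\<in>?lo. real (c v)) \<le> (\<Sum>v\<in>?lo. real (card A))"
    using fin by (intro sum_mono) (auto simp: c_def intro: card_mono)
  also have "\<dots> = real (card A) * real (card ?lo)"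
    by simp
  also have "\<dots> \<le> real (card A) * \<tau>"
    using lo by (rule mult_left_mono) simp
  finally have "(\<Sum>v\<in>?lo. real (c v)) \<le> real (card A) * \<tau>" .
  then have hi: "D \<le> (\<Sum>v\<in>?hi. real (c v))"
    using layers split by (simp add: D_def)
  have hi_ne: "?hi \<noteq> {}"
  proof
    assume "?hi = {}"
    then show False
      using hi D by (simp only: sum.empty)
  qed
  then have "m \<noteq> 0" by auto
  then have harm: "harm m > (0 :: real)"
    by (intro harm_pos) simp
  have "\<exists>v\<in>?hi. D \<le> harm m * real (v * c v)"
  proof (rule ccontr)
    assume "\<not> ?thesis"
    then have "real (c v) < D / harm m * inverse (real v)" if "v \<in> ?hi" for v
      using that harm by (auto simp: field_simps not_le)
    then have "(\<Sum>v\<in>?hi. real (c v)) < (\<Sum>v\<in>?hi. D / harm m * inverse (real v))"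
      using hi_ne by (intro sum_strict_mono) auto
    also have "\<dots> \<le> (\<Sum>v\<in>{1..m}. D / harm m * inverse (real v))"
      by (intro sum_mono2 mult_nonneg_nonneg divide_nonneg_pos) (use D harm in auto)
    also have "\<dots> = D"
      unfolding sum_distrib_left[symmetric] harm_def[symmetric] using less_imp_neq[OF harm] by simp
    finally show False
      using hi by simp
  qed
  then show thesis
    using that unfolding c_def D_def by auto
qed

text \<open>Only a lower bound for the number of edges is assumed here, so that \<open>H\<close> and then \<open>T\<close> are found by a
  pigeonhole over degrees, which costs the logarithms.\<close>

lemma dense_symmetric_graph:
  fixes R :: "'a \<Rightarrow> 'a \<Rightarrow> bool" and N0 :: real
  assumes fin: "finite A" "A \<noteq> {}" and sym: "\<And>a b. R a b \<Longrightarrow> R b a"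
    and N0: "0 < N0" and edges: "real (card A) * N0 \<le> real (\<Sum>a\<in>A. card {b \<in> A. R a b})"
  obtains H T n g where "H \<subseteq> A" "T \<subseteq> A"
    "\<And>h. h \<in> H \<Longrightarrow> n \<le> card {b \<in> A. R h b}" "\<And>t. t \<in> T \<Longrightarrow> g \<le> card {b \<in> H. R t b}"
    "real (card A) ^ 2 * N0 ^ 4
      \<le> 64 * (1 + ln (real (card A))) ^ 4 * real (g ^ 2 * n ^ 2 * card T * min (card T) (card H))"
proof -
  define k where "k = real (card A)"
  define L where "L = 1 + ln k"
  have k: "k \<ge> 1"
    using fin by (simp add: k_def Suc_le_eq card_gt_0_iff)
  then have L: "L \<ge> 1"
    by (simp add: L_def)
  have harm: "harm (card A) * x \<le> L * x" if "x \<ge> 0" for x :: real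
    using harm_le_one_plus_ln[of "card A"] fin that
    by (intro mult_right_mono) (auto simp: L_def k_def card_gt_0_iff)
  have le: "card {b \<in> B. R a b} \<le> card A" if "B \<subseteq> A" for a B
    using that fin by (intro card_mono) auto
  \<comment> \<open>Cutting at half of the average degree keeps at least half of the edge count and
    makes \<open>n\<close> comparable to \<open>N0\<close> from below.\<close>
  obtain n where n: "N0 / 2 < real n" and
    "real (\<Sum>a\<in>A. card {b \<in> A. R a b}) - k * (N0 / 2)
      \<le> harm (card A) * real (n * card {a \<in> A. n \<le> card {b \<in> A. R a b}})"
  proof (rule exists_heavy_level[of A "\<lambda>a. card {b \<in> A. R a b}" "card A" "N0 / 2"])
    have "real (card A) * (N0 / 2) < real (card A) * N0"
      using k N0 by (simp add: k_def)
    then show "real (card A) * (N0 / 2) < real (\<Sum>a\<in>A. card {b \<in> A. R a b})"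
      using edges by linarith
  qed (use fin N0 le in \<open>auto simp: k_def\<close>)
  moreover define H where "H = {a \<in> A. n \<le> card {b \<in> A. R a b}}"
  ultimately have "k * N0 / 2 \<le> harm (card A) * real (n * card H)"
    using edges by (simp add: k_def)
  also have "\<dots> \<le> L * real (n * card H)"
    by (rule harm) simp
  finally have nH: "k * N0 / 2 \<le> L * real (n * card H)" .
  have H: "H \<subseteq> A" by (auto simp: H_def)
  define s where "s = real (n * card H)"
  have s: "k * N0 \<le> 2 * L * s"
    using nH by (simp add: s_def)
  have s0: "s > 0"
    using s k N0 L by (smt (verit) mult_pos_pos zero_less_mult_pos)
  have "(\<Sum>t\<in>A. card {b \<in> H. R t b}) = (\<Sum>h\<in>H. card {t \<in> A. R t h})"
    using fin H finite_subset by (intro sum_card_swap) auto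
  also have "\<dots> = (\<Sum>h\<in>H. card {t \<in> A. R h t})"
    by (intro sum.cong refl arg_cong[of _ _ card]) (use sym in blast)
  also have "\<dots> \<ge> (\<Sum>h\<in>H. n)"
    by (intro sum_mono) (simp add: H_def)
  finally have edges': "s \<le> real (\<Sum>t\<in>A. card {b \<in> H. R t b})"
    unfolding s_def of_nat_le_iff by (simp add: mult.commute)
  \<comment> \<open>The same cut for degrees into \<open>H\<close>, whose average is at least
    \<open>s / k\<close>.\<close>
  obtain g where g: "s / (2 * k) < real g" and
    "real (\<Sum>t\<in>A. card {b \<in> H. R t b}) - k * (s / (2 * k))
      \<le> harm (card A) * real (g * card {t \<in> A. g \<le> card {b \<in> H. R t b}})"
  proof (rule exists_heavy_level[of A "\<lambda>t. card {b \<in> H. R t b}" "card A" "s / (2 * k)"])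
    have "real (card A) * (s / (2 * k)) = s / 2"
      using k by (simp add: k_def)
    then show "real (card A) * (s / (2 * k)) < real (\<Sum>t\<in>A. card {b \<in> H. R t b})"
      using edges' s0 by linarith
  qed (use fin s0 k H le in \<open>auto simp: k_def\<close>)
  moreover define T where "T = {t \<in> A. g \<le> card {b \<in> H. R t b}}"
  ultimately have "s / 2 \<le> harm (card A) * real (g * card T)"
    using edges' k by simp
  also have "\<dots> \<le> L * real (g * card T)"
    by (rule harm) simp
  finally have gT: "s \<le> 2 * L * real (g * card T)"
    by simp
  have gT': "k * N0 \<le> 4 * L ^ 2 * real (g * card T)"
  proof -
    have "2 * L * s \<le> 2 * L * (2 * L * real (g * card T))"
      using gT L by (intro mult_left_mono) auto
    then show ?thesis
      using s by (simp add: power2_eq_square)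
  qed
  have g': "N0 \<le> 4 * L * real g"
  proof -
    have "k * N0 \<le> 2 * L * (2 * k * real g)"
      using s g k L by (smt (verit) divide_less_eq mult.commute mult_left_mono)
    then have "k * N0 \<le> k * (4 * L * real g)"
      by (simp add: ac_simps)
    then show ?thesis
      using k by simp
  qed
  have kN: "0 \<le> k * N0" using k N0 by simp
  \<comment> \<open>Two products of the available bounds, one for each value of the minimum: here
    \<open>gT'\<close> is used twice, below \<open>gT'\<close>, \<open>s\<close> and
    \<open>g'\<close> once each. Both give \<open>64 * L ^ 4\<close>.\<close>
  have 1: "k ^ 2 * N0 ^ 4 \<le> 64 * L ^ 4 * ((real (g * card T)) ^ 2 * real n ^ 2)"
  proof -
    have "(k * N0) ^ 2 * N0 ^ 2 \<le> (4 * L ^ 2 * real (g * card T)) ^ 2 * (2 * real n) ^ 2"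
      by (rule mult_mono[OF power_mono[OF gT' kN] power_mono]) (use n N0 in auto)
    then show ?thesis
      by (simp add: power_mult_distrib power2_eq_square power4_eq_xxxx ac_simps)
  qed
  have 2: "k ^ 2 * N0 ^ 4 \<le> 64 * L ^ 4 * (real (g * card T) * real (n * card H) * (real g * real n))"
  proof -
    have "(k * N0) * (k * N0) * (N0 * N0)
        \<le> (4 * L ^ 2 * real (g * card T)) * (2 * L * real (n * card H)) * ((4 * L * real g) * (2 * real n))"
      by (rule mult_mono[OF mult_mono[OF gT' s[unfolded s_def]] mult_mono[OF g']])
        (use n N0 kN L in auto)
    then show ?thesis
      by (simp add: power2_eq_square power4_eq_xxxx ac_simps)
  qed
  have bound: "k ^ 2 * N0 ^ 4 \<le> 64 * L ^ 4 * real (g ^ 2 * n ^ 2 * card T * min (card T) (card H))"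
  proof (cases "card T \<le> card H")
    case True
    then have "real (g ^ 2 * n ^ 2 * card T * min (card T) (card H)) = (real (g * card T)) ^ 2 * real n ^ 2"
      by (simp add: power2_eq_square)
    then show ?thesis
      using 1 by (simp only:)
  next
    case False
    then have "real (g ^ 2 * n ^ 2 * card T * min (card T) (card H))
        = real (g * card T) * real (n * card H) * (real g * real n)"
      by (simp add: power2_eq_square)
    then show ?thesis
      using 2 by (simp only:)
  qed
  show thesis
  proof (rule that[OF H])
    show "T \<subseteq> A"
      by (auto simp: T_def)
    show "n \<le> card {b \<in> A. R h b}" if "h \<in> H" for h
      using that by (simp add: H_def)
    show "g \<le> card {b \<in> H. R t b}" if "t \<in> T" for t
      using that by (simp add: T_def)
  qed (use bound in \<open>simp only: k_def L_def\<close>)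
qed

text \<open>No logarithm is lost when half of the vertices have degree at least \<open>m\<close>: the vertices of degree
  below \<open>m / 8\<close> meet too few edges to matter for most of them.\<close>

lemma regular_symmetric_graph:
  fixes R :: "'a \<Rightarrow> 'a \<Rightarrow> bool" and m :: real
  assumes fin: "finite A" and sym: "\<And>a b. R a b \<Longrightarrow> R b a" and m: "0 < m"
    and half: "card A \<le> 2 * card {a \<in> A. m \<le> real (card {b \<in> A. R a b})}"
  obtains H T n g where "H \<subseteq> A" "T \<subseteq> A"
    "\<And>h. h \<in> H \<Longrightarrow> n \<le> card {b \<in> A. R h b}" "\<And>t. t \<in> T \<Longrightarrow> g \<le> card {b \<in> H. R t b}"
    "real (card A) ^ 2 * m ^ 4 \<le> 4096 * real (g ^ 2 * n ^ 2 * card T * min (card T) (card H))"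
proof -
  define k where "k = real (card A)"
  define deg where "deg B a = card {b \<in> B. R a b}" for B a
  define n where "n = nat \<lceil>m / 8\<rceil>"
  define g where "g = nat \<lceil>m / 2\<rceil>"
  have n: "m / 8 \<le> real n" and g: "m / 2 \<le> real g"
    unfolding n_def g_def by linarith+
  define H where "H = {a \<in> A. m / 8 \<le> real (deg A a)}"
  define T where "T = {a \<in> A. m / 2 \<le> real (deg H a)}"
  define P where "P = {a \<in> A. m \<le> real (deg A a)}"
  have sub: "H \<subseteq> A" "T \<subseteq> A" "P \<subseteq> A"
    by (auto simp: H_def T_def P_def)
  note finite = finite_subset[OF sub(1) fin] finite_subset[OF sub(2) fin] finite_subset[OF sub(3) fin]
  have P: "k \<le> 2 * real (card P)"
    using half by (simp add: k_def P_def deg_def)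
  have "P \<subseteq> H"
    using m by (auto simp: P_def H_def)
  then have "card P \<le> card H"
    by (intro card_mono finite)
  then have cH: "k \<le> 4 * real (card H)"
    using P by simp
  have split: "deg A a = deg H a + deg (A - H) a" for a
    unfolding deg_def using fin sub(1) finite
    by (subst card_Un_disjoint[symmetric]) (auto intro!: arg_cong[of _ _ card])
  \<comment> \<open>A point of \<open>P - T\<close> sends at least \<open>m / 2\<close> edges
    outside \<open>H\<close>, while all points outside \<open>H\<close> together receive at most
    \<open>k * (m / 8)\<close>. So \<open>P - T\<close> has at most \<open>k / 4\<close> points, and
    at least \<open>k / 4\<close> points of \<open>P\<close> are in \<open>T\<close>.\<close>
  have "(\<Sum>a\<in>P - T. m / 2) \<le> (\<Sum>a\<in>P - T. real (deg (A - H) a))"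
  proof (rule sum_mono)
    fix a assume "a \<in> P - T"
    then show "m / 2 \<le> real (deg (A - H) a)"
      using split[of a] by (auto simp: P_def T_def)
  qed
  also have "\<dots> \<le> (\<Sum>a\<in>A. real (deg (A - H) a))"
    using fin sub by (intro sum_mono2) auto
  also have "\<dots> = (\<Sum>b\<in>A - H. real (card {a \<in> A. R a b}))"
    unfolding deg_def using sum_card_swap[of A "A - H" R] fin by (simp flip: of_nat_sum)
  also have "\<dots> = (\<Sum>b\<in>A - H. real (deg A b))"
    unfolding deg_def by (intro sum.cong refl arg_cong[of _ _ "\<lambda>X. real (card X)"]) (use sym in blast)
  also have "\<dots> \<le> (\<Sum>b\<in>A - H. m / 8)"
    by (intro sum_mono) (auto simp: H_def)
  also have "\<dots> \<le> k * (m / 8)"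
    using m fin card_mono[of A "A - H"] by (auto simp: k_def intro!: mult_right_mono)
  finally have "real (card (P - T)) * 4 \<le> k"
    using m by (simp add: field_simps)
  moreover have "card P \<le> card T + card (P - T)"
    using card_Un_le[of T "P - T"] card_mono[of "T \<union> (P - T)" P] finite by fastforce
  ultimately have cT: "k \<le> 4 * real (card T)"
    using P by linarith
  have min: "k \<le> 4 * real (min (card T) (card H))"
    using cT cH by (simp add: min_def)
  have "k * k * (m * m * (m * m))
      \<le> (4 * real (card T)) * (4 * real (min (card T) (card H))) * ((2 * real g) * (2 * real g) * ((8 * real n) * (8 * real n)))"
    using cT min n g m by (intro mult_mono) (auto simp: k_def)
  then have "k ^ 2 * m ^ 4 \<le> 4096 * real (g ^ 2 * n ^ 2 * card T * min (card T) (card H))"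
    by (simp add: power2_eq_square power4_eq_xxxx ac_simps)
  moreover have "n \<le> card {b \<in> A. R h b}" if "h \<in> H" for h
    using that unfolding H_def n_def deg_def by (simp add: nat_le_iff ceiling_le_iff)
  moreover have "g \<le> card {b \<in> H. R t b}" if "t \<in> T" for t
    using that unfolding T_def g_def deg_def by (simp add: nat_le_iff ceiling_le_iff)
  ultimately show thesis
    using that[of H T n g] sub by (simp add: k_def)
qed

text \<open>There are no more small fibres than values of \<open>f\<close>, and each contains fewer
  than \<open>m\<close> points.\<close>

lemma card_small_fibres:
  fixes f :: "'a \<Rightarrow> 'b"
  assumes "finite D" and m: "0 \<le> m"
  shows "real (card {x \<in> D. real (card {y \<in> D. f y = f x}) < m}) \<le> real (card (f ` D)) * m"
proof -
  define V where "V = {v \<in> f ` D. real (card {y \<in> D. f y = v}) < m}"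
  have V: "finite V" "V \<subseteq> f ` D"
    using assms by (auto simp: V_def)
  have "{x \<in> D. real (card {y \<in> D. f y = f x}) < m} = (\<Union>v\<in>V. {y \<in> D. f y = v})"
    by (auto simp: V_def)
  then have "card {x \<in> D. real (card {y \<in> D. f y = f x}) < m} \<le> (\<Sum>v\<in>V. card {y \<in> D. f y = v})"
    using card_UN_le[OF V(1), of "\<lambda>v. {y \<in> D. f y = v}"] by simp
  then have "real (card {x \<in> D. real (card {y \<in> D. f y = f x}) < m}) \<le> (\<Sum>v\<in>V. real (card {y \<in> D. f y = v}))"
    by (simp flip: of_nat_sum)
  also have "\<dots> \<le> (\<Sum>v\<in>V. m)"
    by (intro sum_mono) (simp add: V_def)
  also have "\<dots> \<le> real (card (f ` D)) * m"
    using m V assms card_mono[of "f ` D" V] by (simp add: mult_right_mono)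
  finally show ?thesis .
qed

section \<open>Graphs of multiplicative coincidences\<close>

context residue_set
begin

text \<open>For fixed \<open>z\<close> this is the adjacency of a graph on \<open>A\<close>:
  symmetric by commutativity, with the sets \<open>covers\<close> as neighbourhoods. It links the
  graph lemmas to \<open>pivot\<close>.\<close>

definition meets :: "int \<Rightarrow> int \<Rightarrow> int \<Rightarrow> bool" where
  "meets z a b \<longleftrightarrow> (\<exists>u\<in>A. [a * b = z * u] (mod p))"

lemma meets_sym: "meets z a b \<Longrightarrow> meets z b a"
  by (simp add: meets_def mult.commute)

lemma covers_eq: "covers p A z a = {b \<in> A. meets z a b}"
  by (simp add: covers_def meets_def)

lemma cong_cancel: "x \<in> A \<Longrightarrow> u \<in> A \<Longrightarrow> u' \<in> A \<Longrightarrow> [x * u = x * u'] (mod p) \<Longrightarrow> u = u'"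
  using cong_scale_iff[of x u u'] not_dvd mod_id by (simp add: cong_def)

text \<open>Each representation of the ratio \<open>z / x\<close> as \<open>u / a\<close> puts
  \<open>a\<close> into \<open>covers p A x z\<close>, so popularity of a ratio directly bounds the
  degree of \<open>z\<close> in the graph of \<open>x\<close>. Most pairs have popular ratios, hence
  for some \<open>x\<close> half of the vertices have high degree and no logarithm arises.
  \<open>f\<close> is any encoding of ratios.\<close>

lemma ratio_pivot:
  assumes small: "int (card A ^ 2) \<le> p" and ne: "A \<noteq> {}"
    and f: "\<And>a b c d. a \<in> A \<Longrightarrow> b \<in> A \<Longrightarrow> c \<in> A \<Longrightarrow> d \<in> A \<Longrightarrow>
      f (a, b) = f (c, d) \<longleftrightarrow> [a * d = c * b] (mod p)"
  shows "real (card A) ^ 10 \<le> 2 ^ 18 * real (card (f ` (A \<times> A))) ^ 4 * real (S ^ 4 * Q)"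
proof -
  define k where "k = real (card A)"
  define \<rho> where "\<rho> = real (card (f ` (A \<times> A)))"
  \<comment> \<open>Half of the average number of representations of a ratio, so that at most half
    of all pairs are bad.\<close>
  define m where "m = k ^ 2 / (2 * \<rho>)"
  have k: "k > 0"
    using ne finite_A by (simp add: k_def card_gt_0_iff)
  have \<rho>: "\<rho> > 0"
    using ne finite_A by (simp add: \<rho>_def card_gt_0_iff)
  have m: "m > 0"
    using k \<rho> by (simp add: m_def)
  define bad where "bad x z \<longleftrightarrow> real (card (covers p A x z)) < m" for x z
  have fibre: "card {w \<in> A \<times> A. f w = f (z, x)} \<le> card (covers p A x z)" if zx: "z \<in> A" "x \<in> A" for z x
  proof -
    have "inj_on snd {w \<in> A \<times> A. f w = f (z, x)}"
    proof (rule inj_onI, clarify)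
      fix u a u' a'
      assume *: "u \<in> A" "a \<in> A" "u' \<in> A" "a' \<in> A" "f (u, a) = f (z, x)" "f (u', a') = f (z, x)"
        "snd (u, a) = snd (u', a')"
      have "[x * u = x * u'] (mod p)"
        using *(5-7) f[of u a z x] f[of u' a' z x] * zx
        by (simp add: mult.commute) (meson cong_sym cong_trans)
      then show "u = u' \<and> a = a'"
        using cong_cancel[of x u u'] * zx by simp
    qed
    moreover have "snd ` {w \<in> A \<times> A. f w = f (z, x)} \<subseteq> covers p A x z"
      using f zx by (auto simp: covers_def) (metis cong_sym mult.commute)
    ultimately show ?thesis
      by (meson card_inj_on_le covers_subset finite_sub)
  qed
  let ?B = "{w \<in> A \<times> A. bad (snd w) (fst w)}"
  have "?B \<subseteq> {w \<in> A \<times> A. real (card {y \<in> A \<times> A. f y = f w}) < m}"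
    using fibre by (auto simp: bad_def) (meson le_less_trans of_nat_le_iff)
  then have "card ?B \<le> card {w \<in> A \<times> A. real (card {y \<in> A \<times> A. f y = f w}) < m}"
    using finite_A by (intro card_mono) auto
  then have "real (card ?B) \<le> \<rho> * m"
    using card_small_fibres[OF finite_cartesian_product[OF finite_A finite_A] less_imp_le[OF m], of f]
    unfolding \<rho>_def by linarith
  then have B: "real (card ?B) \<le> k ^ 2 / 2"
    using \<rho> by (simp add: m_def)
  have "?B = prod.swap ` (SIGMA x:A. {z \<in> A. bad x z})"
    by (auto simp: image_iff)
  then have "card ?B = card (SIGMA x:A. {z \<in> A. bad x z})"
    by (simp add: card_image)
  also have "\<dots> = (\<Sum>x\<in>A. card {z \<in> A. bad x z})"
    using finite_A by simp
  finally have sumB: "(\<Sum>x\<in>A. card {z \<in> A. bad x z}) = card ?B" ..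
  \<comment> \<open>Averaging the negated counts gives a point with at most the average number of
    bad partners.\<close>
  obtain x where x: "x \<in> A" and "sum (\<lambda>x. - real (card {z \<in> A. bad x z})) A \<le> k * - real (card {z \<in> A. bad x z})"
    using exists_ge_average[OF finite_A ne, of "\<lambda>x. - real (card {z \<in> A. bad x z})"] unfolding k_def .
  then have "k * real (card {z \<in> A. bad x z}) \<le> real (\<Sum>x\<in>A. card {z \<in> A. bad x z})"
    by (simp add: sum_negf)
  then have "k * real (card {z \<in> A. bad x z}) \<le> k * (k / 2)"
    using B sumB by (simp add: power2_eq_square)
  then have "real (card {z \<in> A. bad x z}) \<le> k / 2"
    using k by simp
  moreover have "card A = card {z \<in> A. bad x z} + card {z \<in> A. \<not> bad x z}"
    using finite_A by (subst card_Un_disjoint[symmetric]) (auto intro: arg_cong[of _ _ card])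
  ultimately have half: "card A \<le> 2 * card {z \<in> A. \<not> bad x z}"
    by (simp add: k_def)
  obtain H T n g where HT: "H \<subseteq> A" "T \<subseteq> A"
    and n: "\<And>h. h \<in> H \<Longrightarrow> n \<le> card {b \<in> A. meets x h b}"
    and g: "\<And>t. t \<in> T \<Longrightarrow> g \<le> card {b \<in> H. meets x t b}"
    and bound: "k ^ 2 * m ^ 4 \<le> 4096 * real (g ^ 2 * n ^ 2 * card T * min (card T) (card H))"
    unfolding k_def
  proof (rule regular_symmetric_graph[of A "meets x" m])
    show "card A \<le> 2 * card {a \<in> A. m \<le> real (card {b \<in> A. meets x a b})}"
      using half by (simp add: bad_def covers_eq not_less)
  qed (use finite_A meets_sym m in auto)
  have "g ^ 2 * n ^ 2 * card T * min (card T) (card H) \<le> 4 * S ^ 4 * Q"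
  proof (rule pivot)
    show "g \<le> card (covers p A x t \<inter> H)" if "t \<in> T" for t
    proof -
      have "covers p A x t \<inter> H = {b \<in> H. meets x t b}"
        using HT by (auto simp: covers_eq)
      then show ?thesis
        using g[OF that] by simp
    qed
  qed (use HT n x not_dvd small in \<open>auto simp: covers_eq\<close>)
  then have "real (g ^ 2 * n ^ 2 * card T * min (card T) (card H)) \<le> real (4 * S ^ 4 * Q)"
    by (simp only: of_nat_le_iff)
  then have "k ^ 2 * m ^ 4 \<le> 4096 * (4 * real (S ^ 4 * Q))"
    using bound by (simp add: mult.assoc)
  then show ?thesis
    using \<rho> unfolding m_def k_def[symmetric] \<rho>_def[symmetric]
    by (simp add: power_divide power_mult_distrib divide_simps ac_simps flip: power_mult power_add)
qed

text \<open>Coincidences \<open>z * a = x * u\<close> are at least \<open>k ^ 4 / \<rho>\<close> in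
  number. Averaging over \<open>x\<close> yields a graph of which only the number of edges is known,
  so \<open>dense_symmetric_graph\<close> is used, with its logarithms.\<close>

lemma product_pivot:
  assumes small: "int (card A ^ 2) \<le> p" and ne: "A \<noteq> {}"
    and f: "\<And>a b c d. a \<in> A \<Longrightarrow> b \<in> A \<Longrightarrow> c \<in> A \<Longrightarrow> d \<in> A \<Longrightarrow>
      f (a, b) = f (c, d) \<longleftrightarrow> [a * b = c * d] (mod p)"
  shows "real (card A) ^ 10
    \<le> 2 ^ 8 * (1 + ln (real (card A))) ^ 4 * real (card (f ` (A \<times> A))) ^ 4 * real (S ^ 4 * Q)"
proof -
  define k where "k = real (card A)"
  define \<rho> where "\<rho> = real (card (f ` (A \<times> A)))"
  define N0 where "N0 = k ^ 2 / \<rho>"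
  have k: "k > 0"
    using ne finite_A by (simp add: k_def card_gt_0_iff)
  have \<rho>: "\<rho> > 0"
    using ne finite_A by (simp add: \<rho>_def card_gt_0_iff)
  have N0: "N0 > 0"
    using k \<rho> by (simp add: N0_def)
  let ?E = "{w \<in> (A \<times> A) \<times> (A \<times> A). f (fst w) = f (snd w)}"
  let ?F = "SIGMA x:A. SIGMA z:A. covers p A x z"
  have "card ?E \<le> card ?F"
  proof (rule card_inj_on_le)
    \<comment> \<open>The coordinate \<open>u\<close> may be dropped because
      \<open>z * a = x * u\<close> determines it.\<close>
    let ?h = "\<lambda>w :: (int \<times> int) \<times> (int \<times> int). (fst (snd w), fst (fst w), snd (fst w))"
    show "inj_on ?h ?E"
    proof (rule inj_onI)
      fix w w' assume *: "w \<in> ?E" "w' \<in> ?E" "?h w = ?h w'"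
      obtain z a x u where w: "w = ((z, a), x, u)"
        by (metis surj_pair)
      then obtain u' where w': "w' = ((z, a), x, u')"
        using *(3) by (cases w') auto
      have mem: "z \<in> A" "a \<in> A" "x \<in> A" "u \<in> A" "u' \<in> A"
        using * by (auto simp: w w')
      have "f (z, a) = f (x, u)" "f (z, a) = f (x, u')"
        using * by (auto simp: w w')
      then have "[z * a = x * u] (mod p)" "[z * a = x * u'] (mod p)"
        using f mem by blast+
      then have "[x * u = x * u'] (mod p)"
        using cong_sym cong_trans by blast
      then show "w = w'"
        using cong_cancel[of x u u'] mem by (simp add: w w')
    qed
    show "?h ` ?E \<subseteq> ?F"
      using f by (auto simp: covers_def)
    show "finite ?F"
      using finite_A finite_sub[OF covers_subset] by (intro finite_SigmaI) auto
  qed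
  also have "card ?F = (\<Sum>x\<in>A. \<Sum>z\<in>A. card (covers p A x z))"
    using finite_A finite_sub[OF covers_subset] by simp
  finally have E: "card ?E \<le> (\<Sum>x\<in>A. \<Sum>z\<in>A. card (covers p A x z))" .
  have "card (A \<times> A) ^ 2 \<le> card (f ` (A \<times> A)) * card ?E"
    using finite_A by (intro card_square_le_collisions) simp
  also have "\<dots> \<le> card (f ` (A \<times> A)) * (\<Sum>x\<in>A. \<Sum>z\<in>A. card (covers p A x z))"
    using E by (rule mult_le_mono2)
  finally have "real (card (A \<times> A) ^ 2) \<le> real (card (f ` (A \<times> A)) * (\<Sum>x\<in>A. \<Sum>z\<in>A. card (covers p A x z)))"
    by (simp only: of_nat_le_iff)
  then have total: "k ^ 4 \<le> \<rho> * (\<Sum>x\<in>A. real (\<Sum>z\<in>A. card (covers p A x z)))"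
    by (simp add: k_def \<rho>_def card_cartesian_product power2_eq_square power4_eq_xxxx ac_simps)
  obtain x where x: "x \<in> A"
    and "(\<Sum>x\<in>A. real (\<Sum>z\<in>A. card (covers p A x z))) \<le> k * real (\<Sum>z\<in>A. card (covers p A x z))"
    using exists_ge_average[OF finite_A ne, of "\<lambda>x. real (\<Sum>z\<in>A. card (covers p A x z))"] unfolding k_def .
  then have "k ^ 4 \<le> \<rho> * (k * real (\<Sum>z\<in>A. card (covers p A x z)))"
    using total \<rho> by (meson mult_left_mono less_imp_le order_trans)
  then have "k * (k * N0) \<le> k * real (\<Sum>z\<in>A. card (covers p A x z))"
    using \<rho> by (simp add: N0_def field_simps power2_eq_square power4_eq_xxxx)
  then have edges: "k * N0 \<le> real (\<Sum>z\<in>A. card (covers p A x z))"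
    using k by simp
  obtain H T n g where HT: "H \<subseteq> A" "T \<subseteq> A"
    and n: "\<And>h. h \<in> H \<Longrightarrow> n \<le> card {b \<in> A. meets x h b}"
    and g: "\<And>t. t \<in> T \<Longrightarrow> g \<le> card {b \<in> H. meets x t b}"
    and bound: "k ^ 2 * N0 ^ 4
      \<le> 64 * (1 + ln k) ^ 4 * real (g ^ 2 * n ^ 2 * card T * min (card T) (card H))"
    unfolding k_def
    by (rule dense_symmetric_graph[of A "meets x" N0])
      (use finite_A ne meets_sym N0 edges in \<open>auto simp: k_def covers_eq\<close>)
  have "g ^ 2 * n ^ 2 * card T * min (card T) (card H) \<le> 4 * S ^ 4 * Q"
  proof (rule pivot)
    show "g \<le> card (covers p A x t \<inter> H)" if "t \<in> T" for t
    proof -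
      have "covers p A x t \<inter> H = {b \<in> H. meets x t b}"
        using HT by (auto simp: covers_eq)
      then show ?thesis
        using g[OF that] by simp
    qed
  qed (use HT n x not_dvd small in \<open>auto simp: covers_eq\<close>)
  then have "real (g ^ 2 * n ^ 2 * card T * min (card T) (card H)) \<le> real (4 * S ^ 4 * Q)"
    by (simp only: of_nat_le_iff)
  then have "64 * (1 + ln k) ^ 4 * real (g ^ 2 * n ^ 2 * card T * min (card T) (card H))
      \<le> 64 * (1 + ln k) ^ 4 * (4 * real (S ^ 4 * Q))"
    by (intro mult_left_mono) (simp_all add: mult.assoc zero_le_even_power)
  then have "k ^ 2 * N0 ^ 4 \<le> 64 * (1 + ln k) ^ 4 * (4 * real (S ^ 4 * Q))"
    using bound by linarith
  moreover have "k ^ 2 * N0 ^ 4 = k ^ 10 / \<rho> ^ 4"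
    by (simp add: N0_def power_divide flip: power_mult power_add)
  ultimately have "k ^ 10 \<le> 64 * (1 + ln k) ^ 4 * (4 * real (S ^ 4 * Q)) * \<rho> ^ 4"
    using \<rho> by (simp only: pos_divide_le_eq zero_less_power)
  then show ?thesis
    unfolding k_def[symmetric] \<rho>_def[symmetric] by (simp only: mult.assoc mult.commute mult.left_commute) simp
qed

end

section \<open>The sum-product estimate\<close>

context residue_set
begin

text \<open>\<open>pluennecke_large_subset\<close> with summand \<open>s A\<close> bounds the
  fourfold sum by \<open>8 * S ^ 3 / card A ^ 2\<close>; the remaining \<open>S ^ 4\<close> is
  monotonicity.\<close>

lemma exists_good_subset:
  assumes "A \<noteq> {}"
  obtains A' where "A' \<subseteq> A" "A' \<noteq> {}" "card A \<le> 2 * card A'"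
    "card A ^ 2 * (N (A' + (*) s ` A') ^ 4 * N (A' + (*) s ` A' + (*) s ` A' + (*) s ` A')) \<le> 8 * S ^ 7"
proof -
  let ?B = "(*) s ` A"
  have k: "card A > 0"
    using assms finite_A by (simp add: card_gt_0_iff)
  have "inj_on (\<lambda>x. x mod p) A"
    by (rule inj_onI) (simp add: mod_id)
  then obtain A' where A': "A' \<subseteq> A" "card A \<le> 2 * card A'"
    and N: "N (A' + ?B + ?B + ?B) * card A ^ 3 \<le> 8 * S ^ 3 * card A'"
    using pluennecke_large_subset[of A ?B] finite_A by blast
  have fin: "finite A" "finite A'"
    using finite_A A' finite_sub by auto
  let ?B' = "(*) s ` A'"
  have "N (A' + ?B' + ?B' + ?B') \<le> N (A' + ?B + ?B + ?B)"
    using fin A' by (intro N_mono set_plus_mono2 image_mono) (auto simp: finite_set_plus)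
  then have "N (A' + ?B' + ?B' + ?B') * card A ^ 3 \<le> N (A' + ?B + ?B + ?B) * card A ^ 3"
    by (rule mult_le_mono1)
  also have "\<dots> \<le> 8 * S ^ 3 * card A'"
    by (rule N)
  also have "\<dots> \<le> 8 * S ^ 3 * card A"
    using A' fin by (intro mult_le_mono2 card_mono)
  finally have "card A * (card A ^ 2 * N (A' + ?B' + ?B' + ?B')) \<le> card A * (8 * S ^ 3)"
    by (simp add: power2_eq_square power3_eq_cube ac_simps)
  then have Q: "card A ^ 2 * N (A' + ?B' + ?B' + ?B') \<le> 8 * S ^ 3"
    using k by simp
  have "N (A' + ?B') \<le> S"
    using fin A' by (intro N_mono set_plus_mono2 image_mono) (auto simp: finite_set_plus)
  then have "N (A' + ?B') ^ 4 * (card A ^ 2 * N (A' + ?B' + ?B' + ?B')) \<le> S ^ 4 * (8 * S ^ 3)"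
    by (intro mult_le_mono[OF power_mono Q]) simp_all
  also have "S ^ 4 * (8 * S ^ 3) = 8 * S ^ 7"
    by (simp flip: power_add)
  finally have "card A ^ 2 * (N (A' + ?B') ^ 4 * N (A' + ?B' + ?B' + ?B')) \<le> 8 * S ^ 7"
    by (simp only: ac_simps)
  moreover have "A' \<noteq> {}"
    using A'(2) k by auto
  ultimately show thesis
    using that A' by blast
qed

text \<open>The pivot bound is assumed for all subsets, since the good one is not known in advance.
  Replacing \<open>A'\<close> by \<open>A\<close> costs \<open>2 ^ 10\<close>, and \<open>8\<close>
  is the loss in the fourfold sum.\<close>

lemma transfer_pivot:
  assumes ne: "A \<noteq> {}" and C: "0 \<le> C"
    and bound: "\<And>A'. A' \<subseteq> A \<Longrightarrow> A' \<noteq> {} \<Longrightarrow> real (card A') ^ 10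
      \<le> C * real (N (A' + (*) s ` A') ^ 4 * N (A' + (*) s ` A' + (*) s ` A' + (*) s ` A'))"
  shows "real (card A) ^ 12 \<le> 2 ^ 13 * C * real S ^ 7"
proof -
  obtain A' where A': "A' \<subseteq> A" "A' \<noteq> {}" "card A \<le> 2 * card A'"
    and N: "card A ^ 2 * (N (A' + (*) s ` A') ^ 4 * N (A' + (*) s ` A' + (*) s ` A' + (*) s ` A')) \<le> 8 * S ^ 7"
      (is "card A ^ 2 * ?X \<le> _")
    using exists_good_subset[OF ne] .
  have "real (card A) ^ 10 \<le> (2 * real (card A')) ^ 10"
    using A'(3) by (intro power_mono) auto
  also have "\<dots> = 2 ^ 10 * real (card A') ^ 10"
    by (simp add: power_mult_distrib)
  also have "\<dots> \<le> 2 ^ 10 * (C * real ?X)"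
    using bound[OF A'(1,2)] by (intro mult_left_mono) auto
  finally have "real (card A) ^ 10 * real (card A) ^ 2 \<le> 2 ^ 10 * (C * real ?X) * real (card A) ^ 2"
    by (rule mult_right_mono) simp
  also have "\<dots> = 2 ^ 10 * C * real (card A ^ 2 * ?X)"
    by (simp add: ac_simps)
  also have "\<dots> \<le> 2 ^ 10 * C * real (8 * S ^ 7)"
    using N C by (intro mult_left_mono) (simp_all only: of_nat_le_iff, simp)
  finally show ?thesis
    by (simp flip: power_add)
qed

lemma ratio_bound:
  assumes small: "int (card A ^ 2) \<le> p" and ne: "A \<noteq> {}"
    and f: "\<And>a b c d. a \<in> A \<Longrightarrow> b \<in> A \<Longrightarrow> c \<in> A \<Longrightarrow> d \<in> A \<Longrightarrow>
      f (a, b) = f (c, d) \<longleftrightarrow> [a * d = c * b] (mod p)"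
  shows "real (card A) ^ 12 \<le> 2 ^ 31 * real (card (f ` (A \<times> A))) ^ 4 * real S ^ 7"
proof -
  have "real (card A) ^ 12 \<le> 2 ^ 13 * (2 ^ 18 * real (card (f ` (A \<times> A))) ^ 4) * real S ^ 7"
  proof (rule transfer_pivot[OF ne])
    fix A' assume A': "A' \<subseteq> A" "A' \<noteq> {}"
    interpret sub: residue_set p A' s
      by unfold_locales (use A' A s in auto)
    have "card A' ^ 2 \<le> card A ^ 2"
      using A' finite_A by (intro power_mono card_mono) auto
    then have "int (card A' ^ 2) \<le> p"
      using small by linarith
    moreover have "f (a, b) = f (c, d) \<longleftrightarrow> [a * d = c * b] (mod p)"
      if "a \<in> A'" "b \<in> A'" "c \<in> A'" "d \<in> A'" for a b c d
      using f that A' by blast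
    ultimately have "real (card A') ^ 10 \<le> 2 ^ 18 * real (card (f ` (A' \<times> A'))) ^ 4 * real (sub.S ^ 4 * sub.Q)"
      using sub.ratio_pivot A' by blast
    also have "\<dots> \<le> 2 ^ 18 * real (card (f ` (A \<times> A))) ^ 4 * real (sub.S ^ 4 * sub.Q)"
      using A' finite_A
      by (intro mult_right_mono mult_left_mono power_mono of_nat_mono card_mono image_mono Sigma_mono) auto
    finally show "real (card A') ^ 10 \<le> 2 ^ 18 * real (card (f ` (A \<times> A))) ^ 4 * real (sub.S ^ 4 * sub.Q)" .
  qed simp
  then show ?thesis
    by simp
qed

lemma product_bound:
  assumes small: "int (card A ^ 2) \<le> p" and two: "2 \<le> card A"
    and f: "\<And>a b c d. a \<in> A \<Longrightarrow> b \<in> A \<Longrightarrow> c \<in> A \<Longrightarrow> d \<in> A \<Longrightarrow>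
      f (a, b) = f (c, d) \<longleftrightarrow> [a * b = c * d] (mod p)"
  shows "real (card A) ^ 12 \<le> 2 ^ 31 * ln (real (card A)) ^ 4 * real (card (f ` (A \<times> A))) ^ 4 * real S ^ 7"
proof -
  let ?l = "ln (real (card A))"
  have ne: "A \<noteq> {}"
    using two by auto
  have "ln 2 \<le> ?l"
    using two by simp
  then have l: "2 / 3 \<le> ?l"
    using ln2_ge_two_thirds by linarith
  have "real (card A) ^ 12 \<le> 2 ^ 13 * (2 ^ 8 * (1 + ?l) ^ 4 * real (card (f ` (A \<times> A))) ^ 4) * real S ^ 7"
  proof (rule transfer_pivot[OF ne])
    fix A' assume A': "A' \<subseteq> A" "A' \<noteq> {}"
    interpret sub: residue_set p A' s
      by unfold_locales (use A' A s in auto)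
    have cA': "card A' \<le> card A" "0 < card A'"
      using A' finite_A sub.finite_A by (auto simp: card_mono card_gt_0_iff)
    then have "card A' ^ 2 \<le> card A ^ 2"
      by (intro power_mono) auto
    then have "int (card A' ^ 2) \<le> p"
      using small by linarith
    moreover have "f (a, b) = f (c, d) \<longleftrightarrow> [a * b = c * d] (mod p)"
      if "a \<in> A'" "b \<in> A'" "c \<in> A'" "d \<in> A'" for a b c d
      using f that A' by blast
    ultimately have "real (card A') ^ 10
        \<le> 2 ^ 8 * (1 + ln (real (card A'))) ^ 4 * real (card (f ` (A' \<times> A'))) ^ 4 * real (sub.S ^ 4 * sub.Q)"
      using sub.product_pivot A' by blast
    also have "\<dots> \<le> 2 ^ 8 * (1 + ?l) ^ 4 * real (card (f ` (A \<times> A))) ^ 4 * real (sub.S ^ 4 * sub.Q)"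
    proof (rule mult_right_mono[OF mult_mono])
      show "2 ^ 8 * (1 + ln (real (card A'))) ^ 4 \<le> 2 ^ 8 * (1 + ?l) ^ 4"
        using cA' by (intro mult_left_mono power_mono) (auto intro!: add_nonneg_nonneg)
      show "real (card (f ` (A' \<times> A'))) ^ 4 \<le> real (card (f ` (A \<times> A))) ^ 4"
        using A' finite_A by (intro power_mono of_nat_mono card_mono image_mono Sigma_mono) auto
    qed auto
    finally show "real (card A') ^ 10
        \<le> 2 ^ 8 * (1 + ?l) ^ 4 * real (card (f ` (A \<times> A))) ^ 4 * real (sub.S ^ 4 * sub.Q)" .
  qed simp
  \<comment> \<open>Since \<open>ln 2 \<ge> 2 / 3\<close>, the term \<open>1 + ?l\<close> is at most
    \<open>3 * ?l\<close>. The resulting \<open>81\<close> is absorbed below, in rounding up to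
    \<open>2 ^ 31\<close>.\<close>
  also have "\<dots> \<le> 2 ^ 13 * (2 ^ 8 * (3 * ?l) ^ 4 * real (card (f ` (A \<times> A))) ^ 4) * real S ^ 7"
  proof -
    have "(1 + ?l) ^ 4 \<le> (3 * ?l) ^ 4"
      using l by (intro power_mono) auto
    then show ?thesis
      by (intro mult_left_mono mult_right_mono) simp_all
  qed
  also have "\<dots> = 2 ^ 21 * 81 * (?l ^ 4 * real (card (f ` (A \<times> A))) ^ 4 * real S ^ 7)"
  proof -
    have "2 ^ 13 * (2 ^ 8 * (3 * a) ^ 4 * b) * c = 2 ^ 21 * 81 * (a ^ 4 * b * c)" for a b c :: real
      by (simp add: power_mult_distrib)
    then show ?thesis .
  qed
  also have "\<dots> \<le> 2 ^ 31 * (?l ^ 4 * real (card (f ` (A \<times> A))) ^ 4 * real S ^ 7)"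
    by (intro mult_right_mono) simp_all
  finally show ?thesis
    by (simp only: mult.assoc)
qed

end

text \<open>Both \<open>x\<close> and \<open>y\<close> are replaced by their maximum, which gives
  total exponent \<open>4 + 7 = 11\<close>, and an eleventh root is taken. The choice
  \<open>l = 1\<close> covers the bounds without logarithm.\<close>

lemma sum_product_exponent:
  fixes k l :: real and x y :: nat
  assumes k: "0 < k" and l: "0 < l" and bound: "k ^ 12 \<le> 2 ^ 31 * l ^ 4 * real x ^ 4 * real y ^ 7"
  shows "1 / 8 * k powr (1 + 1 / 11) * (1 / l powr (4 / 11)) \<le> real (max x y)"
proof -
  let ?d = "real (max x y)"
  let ?b = "1 / 8 * k powr (1 + 1 / 11) * (1 / l powr (4 / 11))"
  have "(k powr (1 + 1 / 11)) ^ 11 = k powr 12"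
    using k by (simp add: powr_power)
  also have "\<dots> = k ^ 12"
    using k powr_realpow[of k 12] by simp
  finally have k11: "(k powr (1 + 1 / 11)) ^ 11 = k ^ 12" .
  have "(l powr (4 / 11)) ^ 11 = l powr 4"
    using l by (simp add: powr_power)
  also have "\<dots> = l ^ 4"
    using l powr_realpow[of l 4] by simp
  finally have l11: "(l powr (4 / 11)) ^ 11 = l ^ 4" .
  have "real x ^ 4 * real y ^ 7 \<le> ?d ^ 4 * ?d ^ 7"
    by (intro mult_mono power_mono) auto
  \<comment> \<open>Rounding \<open>2 ^ 31\<close> up to \<open>2 ^ 33 = 8 ^ 11\<close> makes the
    constant the reciprocal of an integer, \<open>1 / 8\<close>.\<close>
  then have "2 ^ 31 * l ^ 4 * (real x ^ 4 * real y ^ 7) \<le> 2 ^ 33 * l ^ 4 * ?d ^ 11"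
    using l by (intro mult_mono) (auto simp flip: power_add)
  then have "k ^ 12 \<le> 2 ^ 33 * l ^ 4 * ?d ^ 11"
    using bound by (simp only: mult.assoc)
  moreover have "?b ^ 11 = k ^ 12 / (2 ^ 33 * l ^ 4)"
    unfolding power_mult_distrib power_divide k11 l11 by simp
  ultimately have "?b ^ Suc 10 \<le> ?d ^ Suc 10"
    using l by (simp add: divide_le_eq mult.commute)
  then show ?thesis
    by (rule power_le_imp_le_base) simp
qed

section \<open>Translation to the residue ring\<close>

context residues_prime
begin

lemma residue_set_Units:
  assumes "A \<subseteq> Units R" "s = 1 \<or> s = - 1"
  shows "residue_set (int p) A s"
proof unfold_locales
  show "A \<subseteq> {1..<int p}"
  proof
    fix x assume "x \<in> A"
    then have "x \<in> {1..int (p - 1)}"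
      using assms(1) res_prime_units_eq by blast
    then show "x \<in> {1..<int p}"
      using prime_gt_0_nat[OF p_prime] by auto
  qed
qed (use assms p_prime in auto)

text \<open>The dilation by \<open>1\<close> is written out so that the right-hand side matches the
  set counted by \<open>S\<close> for \<open>s = 1\<close>.\<close>

lemma sumset_eq: "A <+>\<^bsub>R\<^esub> B = (\<lambda>x. x mod int p) ` (A + (*) 1 ` B)"
  by (auto simp: set_add_def' res_add_eq set_plus_def)

lemma diff_set_eq: "diff_set R A B = (\<lambda>x. x mod int p) ` (A + (*) (- 1) ` B)"
proof -
  have "a \<ominus>\<^bsub>R\<^esub> b = (a + - 1 * b) mod int p" for a b
    by (simp add: a_minus_def res_neg_eq res_add_eq mod_add_right_eq mod_diff_right_eq)
  then show ?thesis
    unfolding diff_set_def set_plus_def by auto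
qed

lemma product_set_eq: "A <#>\<^bsub>R\<^esub> B = (\<lambda>(a, b). a * b mod int p) ` (A \<times> B)"
  by (auto simp: set_mult_def res_mult_eq image_iff)

lemma ratio_set_eq: "ratio_set R A B = (\<lambda>(a, b). a \<otimes>\<^bsub>R\<^esub> inv\<^bsub>R\<^esub> b) ` (A \<times> B)"
  by (auto simp: ratio_set_def image_iff)

text \<open>Multiplication by the unit \<open>b * d\<close> clears both inverses.\<close>

lemma ratio_eq_iff:
  assumes "a \<in> Units R" "b \<in> Units R" "c \<in> Units R" "d \<in> Units R"
  shows "a \<otimes>\<^bsub>R\<^esub> inv\<^bsub>R\<^esub> b = c \<otimes>\<^bsub>R\<^esub> inv\<^bsub>R\<^esub> d \<longleftrightarrow> [a * d = c * b] (mod int p)"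
proof -
  have inv: "[x * inv\<^bsub>R\<^esub> x = 1] (mod int p)" if "x \<in> Units R" for x
    using Units_r_inv[OF that] m_gt_one by (simp add: res_mult_eq res_one_eq cong_def)
  have "\<not> int p dvd b * d"
    using assms p_prime by (auto simp: res_prime_units_eq prime_dvd_mult_iff zdvd_not_zless)
  then have "coprime (b * d) (int p)"
    using p_coprime_right_int by blast
  then have "[a * inv\<^bsub>R\<^esub> b = c * inv\<^bsub>R\<^esub> d] (mod int p)
      \<longleftrightarrow> [(b * d) * (a * inv\<^bsub>R\<^esub> b) = (b * d) * (c * inv\<^bsub>R\<^esub> d)] (mod int p)"
    by (simp add: cong_mult_lcancel)
  also have "\<dots> \<longleftrightarrow> [(a * d) * (b * inv\<^bsub>R\<^esub> b) = (c * b) * (d * inv\<^bsub>R\<^esub> d)] (mod int p)"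
    by (simp add: ac_simps)
  also have "\<dots> \<longleftrightarrow> [a * d = c * b] (mod int p)"
    using cong_scalar_left[OF inv[OF assms(2)], of "a * d"] cong_scalar_left[OF inv[OF assms(4)], of "c * b"]
    by (metis cong_sym cong_trans mult.right_neutral)
  finally show ?thesis
    by (simp add: res_mult_eq cong_def)
qed

end

theorem mainTheorem2:
  shows "\<exists>(c::real) (p0::nat). c > 0 \<and>
    (\<forall>(p::nat) (A::int set).
      prime p \<longrightarrow> p > p0 \<longrightarrow>
      A \<subseteq> Units (residue_ring (int p)) \<longrightarrow>
      2 \<le> card A \<longrightarrow> real (card A) < sqrt (real p) \<longrightarrow>
        real (max (card (A <#>\<^bsub>residue_ring (int p)\<^esub> A))
                  (card (diff_set (residue_ring (int p)) A A)))
          \<ge> c * real (card A) powr (1 + 1/11) * (1 / ln (real (card A)) powr (4/11))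
      \<and> real (max (card (ratio_set (residue_ring (int p)) A A))
                  (card (A <+>\<^bsub>residue_ring (int p)\<^esub> A)))
          \<ge> c * real (card A) powr (1 + 1/11)
      \<and> real (max (card (ratio_set (residue_ring (int p)) A A))
                  (card (diff_set (residue_ring (int p)) A A)))
          \<ge> c * real (card A) powr (1 + 1/11))"
proof (intro exI[of _ "1 / 8 :: real"] exI[of _ "0 :: nat"] conjI[of "_ < _"] allI impI)
  fix p :: nat and A :: "int set"
  assume p: "prime p" and A: "A \<subseteq> Units (residue_ring (int p))" and two: "2 \<le> card A"
    and small: "real (card A) < sqrt (real p)"
  let ?R = "residue_ring (int p)"
  interpret residues_prime p ?R
    by unfold_locales (use p in auto)
  have "real (card A) ^ 2 < sqrt (real p) ^ 2"
    using small by (intro power_strict_mono) auto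
  then have "real (card A ^ 2) < real p"
    by simp
  then have small': "int (card A ^ 2) \<le> int p"
    by linarith
  have ne: "A \<noteq> {}" and k: "0 < real (card A)" and l: "0 < ln (real (card A))"
    using two by auto
  interpret plus: residue_set "int p" A 1
    using A by (intro residue_set_Units) auto
  interpret minus: residue_set "int p" A "- 1"
    using A by (intro residue_set_Units) auto
  let ?prod = "\<lambda>(a, b). a * b mod int p" and ?ratio = "\<lambda>(a, b). a \<otimes>\<^bsub>?R\<^esub> inv\<^bsub>?R\<^esub> b"
  have ratio: "?ratio (a, b) = ?ratio (c, d) \<longleftrightarrow> [a * d = c * b] (mod int p)"
    if "a \<in> A" "b \<in> A" "c \<in> A" "d \<in> A" for a b c d
    using ratio_eq_iff[of a b c d] that A by auto
  have sums: "card (A <+>\<^bsub>?R\<^esub> A) = plus.S" "card (diff_set ?R A A) = minus.S"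
    unfolding sumset_eq diff_set_eq plus.N_def by (rule refl)+
  have "real (card A) ^ 12 \<le> 2 ^ 31 * ln (real (card A)) ^ 4 * real (card (A <#>\<^bsub>?R\<^esub> A)) ^ 4
      * real (card (diff_set ?R A A)) ^ 7"
    unfolding sums product_set_eq by (rule minus.product_bound[OF small' two]) (simp add: cong_def)
  then have 1: "1 / 8 * real (card A) powr (1 + 1/11) * (1 / ln (real (card A)) powr (4/11))
      \<le> real (max (card (A <#>\<^bsub>?R\<^esub> A)) (card (diff_set ?R A A)))"
    by (rule sum_product_exponent[OF k l])
  \<comment> \<open>The factor \<open>1 ^ 4\<close> stands in the place of \<open>l ^ 4\<close>, so
    that \<open>sum_product_exponent\<close> applies with \<open>l = 1\<close>.\<close>
  have "real (card A) ^ 12 \<le> 2 ^ 31 * 1 ^ 4 * real (card (ratio_set ?R A A)) ^ 4 * real (card (A <+>\<^bsub>?R\<^esub> A)) ^ 7"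
    unfolding sums ratio_set_eq using plus.ratio_bound[OF small' ne ratio] by simp
  then have 2: "1 / 8 * real (card A) powr (1 + 1/11)
      \<le> real (max (card (ratio_set ?R A A)) (card (A <+>\<^bsub>?R\<^esub> A)))"
    using sum_product_exponent[OF k zero_less_one] by simp
  have "real (card A) ^ 12 \<le> 2 ^ 31 * 1 ^ 4 * real (card (ratio_set ?R A A)) ^ 4 * real (card (diff_set ?R A A)) ^ 7"
    unfolding sums ratio_set_eq using minus.ratio_bound[OF small' ne ratio] by simp
  then have 3: "1 / 8 * real (card A) powr (1 + 1/11)
      \<le> real (max (card (ratio_set ?R A A)) (card (diff_set ?R A A)))"
    using sum_product_exponent[OF k zero_less_one] by simp
  show "real (max (card (A <#>\<^bsub>?R\<^esub> A)) (card (diff_set ?R A A)))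
        \<ge> 1 / 8 * real (card A) powr (1 + 1/11) * (1 / ln (real (card A)) powr (4/11))
      \<and> real (max (card (ratio_set ?R A A)) (card (A <+>\<^bsub>?R\<^esub> A)))
        \<ge> 1 / 8 * real (card A) powr (1 + 1/11)
      \<and> real (max (card (ratio_set ?R A A)) (card (diff_set ?R A A)))
        \<ge> 1 / 8 * real (card A) powr (1 + 1/11)"
    using 1 2 3 by blast
qed simp

end
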